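(* Let $r\ge 3$ be an integer that is not a multiple of $4$, let $V_r=\{0,1,\dots,r-1\}$, and let $\xi,\eta\in V_r^{\infty}$ be two infinite sequences. Then the (unpointed) graphs $\Gamma_\xi^{(r)}$ and $\Gamma_\eta^{(r)}$ are isomorphic if and only if there exists $\sigma\in D_r$ such that $\eta$ and $\sigma(\xi)$ are cofinal.
   Context: Fix an integer $r\ge 3$ not divisible by $4$; letters of $V_r=\{0,\dots,r-1\}$ are read modulo $r$. Put $f(r)=\min\{i : 4i>r\}$ and $\widetilde f(r)=2f(r)$. Finite Sierpinski graphs. $\Gamma_1^{(r)}$ is the cycle graph $P_r$ on the vertex set $V_r$, with $i$ adjacent to $i\pm1$ mod $r$. For $k\ge2$, $\Gamma_k^{(r)}$ is obtained from $r$ copies of $\Gamma_{k-1}^{(r)}$, numbered $0,\dots,r-1$, where the vertex labelled $v$ of the $i$-th copy receives the label $vi$ (the letter $i$ is appended on the right), by identifying, for every $i\in V_r$, the vertex $(i+f(r))^{k-1}\,i$ of copy $i$ with the vertex $((i+1)+\widetilde f(r))^{k-1}\,(i+1)$ of copy $i+1$ (letters mod $r$; $a^{k-1}$ is the word $a\cdots a$ of length $k-1$). Thus every word of length $k$ over $V_r$ labels a vertex of $\Gamma_k^{(r)}$ (a vertex may have several labels). For example, for $r=6$ one has $f(6)=2$ and $\widetilde f(6)=4$, and in $\Gamma_3^{(6)}$ the vertex $004$ is identified with $335$, and $115$ with $440$. All graphs carry the path metric with edges of length $1$. Limit graphs. A sequence of pointed graphs $(X_m,p_m)$ strongly converges in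 the Gromov-Hausdorff sense to a pointed graph $(X,p)$ if for every $R>0$ there is $M(R)>0$ such that for every $m>M(R)$ there is an isometry between the balls $B_{X_m}(p_m,R)$ and $B_X(p,R)$ sending $p_m$ to $p$. For $\xi=x_1x_2\cdots\in V_r^\infty$ let $\xi[k]=x_1\cdots x_k$. The pointed graph $(\Gamma_\xi^{(r)},\xi)$ is the limit, in this sense, of the pointed graphs $(\Gamma_k^{(r)},\xi[k])$ as $k\to\infty$; $\Gamma_\xi^{(r)}$ is this graph with the base point forgotten. Dihedral action and cofinality. $D_r\le \mathrm{Sym}(V_r)$ is the dihedral group of order $2r$ of all automorphisms (isometries) of the cycle $P_r$; it acts on $V_r^\infty$ letterwise: $\sigma(x_1x_2\cdots)=\sigma(x_1)\sigma(x_2)\cdots$. Two sequences $x_1x_2\cdots$ and $y_1y_2\cdots$ in $V_r^\infty$ are cofinal if there is $N\in\mathbb{N}$ such that $x_i=y_i$ for all $i\ge N$.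
   Formalization: The second gluing offset is taken to be r − f(r) instead of 2f(r); modulo r these agree for r = 3, 6, 9, and for every other admissible r the claim with 2f(r) is false, because reflections in D_r then need not give isomorphic graphs. *)

theory Defs
  imports Complex_Main "HOL-Combinatorics.Permutations"
begin

record 'v graph =
  verts :: "'v set"
  edges :: "'v rel"

definition simple_graph :: "'v graph \<Rightarrow> bool" where
  "simple_graph G \<longleftrightarrow> edges G \<subseteq> verts G \<times> verts G \<and> sym (edges G) \<and> irrefl (edges G)"

definition connected_graph :: "'v graph \<Rightarrow> bool" where
  "connected_graph G \<longleftrightarrow> (\<forall>u\<in>verts G. \<forall>v\<in>verts G. (u, v) \<in> (edges G)\<^sup>*)"

definition graph_isomorphism :: "('v \<Rightarrow> 'w) \<Rightarrow> 'v graph \<Rightarrow> 'w graph \<Rightarrow> bool" where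
  "graph_isomorphism \<phi> G H \<longleftrightarrow> bij_betw \<phi> (verts G) (verts H) \<and>
     (\<forall>u\<in>verts G. \<forall>v\<in>verts G. (u, v) \<in> edges G \<longleftrightarrow> (\<phi> u, \<phi> v) \<in> edges H)"

definition isomorphic :: "'v graph \<Rightarrow> 'w graph \<Rightarrow> bool" where
  "isomorphic G H \<longleftrightarrow> (\<exists>\<phi>. graph_isomorphism \<phi> G H)"

text \<open>The path metric with edges of length 1; meaningful only inside a connected component.\<close>

definition path_dist :: "'v graph \<Rightarrow> 'v \<Rightarrow> 'v \<Rightarrow> nat" where
  "path_dist G u v = (LEAST n. (u, v) \<in> edges G ^^ n)"

definition graph_ball :: "'v graph \<Rightarrow> 'v \<Rightarrow> real \<Rightarrow> 'v set" where
  "graph_ball G p R = {v \<in> verts G. real (path_dist G p v) \<le> R}"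

definition pointed_ball_isometry ::
    "('v \<Rightarrow> 'w) \<Rightarrow> 'v graph \<Rightarrow> 'v \<Rightarrow> 'w graph \<Rightarrow> 'w \<Rightarrow> real \<Rightarrow> bool" where
  "pointed_ball_isometry \<phi> G p H q R \<longleftrightarrow>
     bij_betw \<phi> (graph_ball G p R) (graph_ball H q R) \<and>
     (\<forall>u\<in>graph_ball G p R. \<forall>v\<in>graph_ball G p R.
        path_dist H (\<phi> u) (\<phi> v) = path_dist G u v) \<and>
     \<phi> p = q"

text \<open>Strong pointed Gromov-Hausdorff convergence. Connectedness of the limit is what makes
  the path metric a metric on it; without it the limit would not be unique up to isometry.\<close>

definition strongly_converges ::
    "(nat \<Rightarrow> 'v graph) \<Rightarrow> (nat \<Rightarrow> 'v) \<Rightarrow> 'w graph \<Rightarrow> 'w \<Rightarrow> bool" where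
  "strongly_converges Xs ps X p \<longleftrightarrow>
     simple_graph X \<and> connected_graph X \<and> p \<in> verts X \<and>
     (\<forall>R>0. \<exists>M>0. \<forall>m>M. \<exists>\<phi>. pointed_ball_isometry \<phi> (Xs m) (ps m) X p R)"

definition cycle_graph :: "nat \<Rightarrow> nat graph" where
  "cycle_graph r = \<lparr>verts = {..<r},
     edges = {(i, j). i < r \<and> j < r \<and> (j = (i + 1) mod r \<or> i = (j + 1) mod r)}\<rparr>"

definition dihedral :: "nat \<Rightarrow> (nat \<Rightarrow> nat) set" where
  "dihedral r = {\<sigma>. \<sigma> permutes {..<r} \<and> graph_isomorphism \<sigma> (cycle_graph r) (cycle_graph r)}"

definition corner :: "nat \<Rightarrow> nat" where
  "corner r = (LEAST i. r < 4 * i)"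

text \<open>The two attaching corners of copy \<open>i\<close> are at the offsets \<open>f(r) = corner r\<close> (towards copy
  \<open>i + 1\<close>) and \<open>corner' r\<close> (towards copy \<open>i - 1\<close>), exchanged by the reflection of the cycle
  fixing \<open>i\<close>; thus \<open>corner' r = - f(r)\<close> modulo \<open>r\<close>.

  Erratum: the source text writes \<open>2 f(r)\<close> for the second offset. Modulo \<open>r\<close> the two agree only if
  \<open>r\<close> divides \<open>3 f(r)\<close>, i.e. for \<open>r = 3, 6, 9\<close>. For every other \<open>r\<close> (e.g. 5, 7, 10) the literal
  value gives graphs without reflection symmetry, for which the dihedral classification is false
  (only the rotations in \<open>dihedral r\<close> act by isomorphisms).\<close>

definition corner' :: "nat \<Rightarrow> nat" where
  "corner' r = r - corner r"

definition words :: "nat \<Rightarrow> nat \<Rightarrow> nat list set" where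
  "words r k = {w. length w = k \<and> set w \<subseteq> {..<r}}"

text \<open>Two words of length \<open>k\<close> label the same vertex of the \<open>k\<close>-th finite graph. Appending a
  letter \<open>i\<close> passes to the \<open>i\<close>-th copy inside the next graph; \<open>glue\<close> gives the identifications
  between consecutive copies. Related words always have the same length.\<close>

inductive same_vertex :: "nat \<Rightarrow> nat list \<Rightarrow> nat list \<Rightarrow> bool" for r where
  letter: "i < r \<Longrightarrow> same_vertex r [i] [i]"
| copy: "same_vertex r u v \<Longrightarrow> i < r \<Longrightarrow> same_vertex r (u @ [i]) (v @ [i])"
| glue: "i < r \<Longrightarrow> k \<ge> 2 \<Longrightarrow>
    same_vertex r (replicate (k - 1) ((i + corner r) mod r) @ [i])
                  (replicate (k - 1) ((i + 1 + corner' r) mod r) @ [(i + 1) mod r])"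
| sym: "same_vertex r u v \<Longrightarrow> same_vertex r v u"
| trans: "same_vertex r u v \<Longrightarrow> same_vertex r v w \<Longrightarrow> same_vertex r u w"

inductive label_edge :: "nat \<Rightarrow> nat list \<Rightarrow> nat list \<Rightarrow> bool" for r where
  cycle: "(i, j) \<in> edges (cycle_graph r) \<Longrightarrow> label_edge r [i] [j]"
| copy: "label_edge r u v \<Longrightarrow> i < r \<Longrightarrow> label_edge r (u @ [i]) (v @ [i])"

text \<open>A vertex is represented by the set of all its labels.\<close>

definition vertex :: "nat \<Rightarrow> nat list \<Rightarrow> nat list set" where
  "vertex r w = {v. same_vertex r w v}"

text \<open>Only levels \<open>k \<ge> 1\<close> are meaningful.\<close>

definition sierpinski :: "nat \<Rightarrow> nat \<Rightarrow> nat list set graph" where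
  "sierpinski r k = \<lparr>verts = vertex r ` words r k,
     edges = {(vertex r u, vertex r v) | u v. u \<in> words r k \<and> v \<in> words r k \<and> label_edge r u v}\<rparr>"

text \<open>Infinite sequences are indexed from 0, so the letter \<open>x\<^sub>n\<close> of the sequence \<open>\<xi>\<close> is \<open>\<xi> (n - 1)\<close>.\<close>

definition seq_prefix :: "(nat \<Rightarrow> nat) \<Rightarrow> nat \<Rightarrow> nat list" where
  "seq_prefix \<xi> k = map \<xi> [0..<k]"

text \<open>The limit is determined only up to pointed isometry; since it is connected and locally
  finite, hence countable and in fact infinite, it can be realised with vertices in \<open>nat\<close>.\<close>

definition pointed_limit :: "nat \<Rightarrow> (nat \<Rightarrow> nat) \<Rightarrow> nat graph \<times> nat" where
  "pointed_limit r \<xi> = (SOME (X, p).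
     strongly_converges (sierpinski r) (\<lambda>k. vertex r (seq_prefix \<xi> k)) X p)"

definition limit_graph :: "nat \<Rightarrow> (nat \<Rightarrow> nat) \<Rightarrow> nat graph" where
  "limit_graph r \<xi> = fst (pointed_limit r \<xi>)"

definition cofinal_seqs :: "(nat \<Rightarrow> nat) \<Rightarrow> (nat \<Rightarrow> nat) \<Rightarrow> bool" where
  "cofinal_seqs x y \<longleftrightarrow> (\<exists>N. \<forall>i\<ge>N. x i = y i)"

end

theory Submission
  imports Defs "HOL-Library.Diagonal_Subsequence" "HOL-Library.Countable_Set"
begin

text \<open>An infinite word over the letters \<open>0, \<dots>, r - 1\<close> is read as an address: cutting off its first
\<open>k\<close> letters leaves the name of a copy of the \<open>k\<close>-th finite graph, and the letters cut off say
where the point lies in that copy. Two addresses that agree from some place on are points of the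
same infinite graph, and the gluing rule pairs up some of them (they are \<open>linked\<close>). The quotient
\<open>gasket \<xi>\<close> of the cofinality class of \<open>\<xi>\<close> by this pairing is the limit graph up to isomorphism
(\<open>limit_graph_isomorphic_gasket\<close>): every finite part of it already lies in a finite graph, and a
locally finite strong limit is determined up to isomorphism by compactness
(\<open>strong_limit_unique\<close>). In particular the graph depends on \<open>\<xi>\<close> only through its cofinality
class. An element of the dihedral group acts letterwise on addresses and respects adjacency and the
pairing, which gives one direction of the classification (\<open>dihedral_imp_gasket_iso\<close>).

For the converse, the nested copies have to be recovered from the bare graph. The device is the
address graph: keep linked addresses apart and join them by an edge of a second kind. Its cells,
the \<open>r\<close>-cycles formed by the addresses with a common tail, are disjoint; forgetting the first
letter contracts each cell to one vertex and maps the link edges injectively to edges of the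
address graph again. Contraction also preserves evenness, where a finite edge set is even if every
vertex lies on an even number of its edges. So an even set that uses link edges contracts to a
smaller nonempty even set, and induction shows that a nonempty even set has at least \<open>r\<close> edges,
with equality only for a cell (\<open>even_set_girth\<close>). Even sets play the part of cycles here because
they can be contracted without following a walk.

Consequently an isomorphism of address graphs maps cells to cells and descends to an isomorphism
for the tails, and so on through all levels. On each cell it is a dihedral permutation of the first
letter. Links between neighbouring cells sit at the two corners \<open>i + f\<close> and \<open>i - f\<close>, so the
permutations of two successive levels agree there; as \<open>r\<close> does not divide \<open>4 f\<close>, a rotation and
a reflection cannot agree at both, and the permutations are equal (\<open>letter_map_step\<close>). Hence one
\<open>\<sigma>\<close> acts on all letters (\<open>address_iso_imp_dihedral\<close>).

What remains is to pass from the gasket to address graphs. For \<open>r = 3\<close> and \<open>r = 5\<close> the hole in the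
middle of the second finite graph is an \<open>r\<close>-cycle too, so cells are not simply the even sets with
\<open>r\<close> edges. But each cell has an edge, one at its vertex \<open>i\<close> when it is the \<open>i\<close>-th cell of its
ring, that lies in no other even set of \<open>r\<close> edges (\<open>short_even_set_at_tip\<close>), whereas every edge of
a hole lies in its cell as well. Cells are thereby visible in the gasket, and since two cells share
a vertex exactly if their tails are adjacent in the address graph, an isomorphism of gaskets induces
one of the address graphs one level up (\<open>gasket_iso_imp_address_iso\<close>).\<close>


section \<open>Even edge sets\<close>

text \<open>Even edge sets are the elements of the cycle space over the field with two elements. Edges are
written as sets of their end points.\<close>

definition even_set :: "'v set set \<Rightarrow> bool" where
  "even_set E \<longleftrightarrow> finite E \<and> (\<forall>x. even (card {e \<in> E. x \<in> e}))"

text \<open>Counting incidences by vertices and by edges. Restricting the vertices to a set \<open>F\<close> is what makes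
this usable for contraction, where \<open>F\<close> is a fibre.\<close>

lemma handshake:
  assumes "finite E" "finite F"
  shows "(\<Sum>x\<in>F. card {e \<in> E. x \<in> e}) = (\<Sum>e\<in>E. card (e \<inter> F))"
proof -
  have "(\<Sum>x\<in>F. card {e \<in> E. x \<in> e}) = (\<Sum>x\<in>F. \<Sum>e\<in>E. if x \<in> e then 1 else 0)"
    using assms by (simp flip: sum.inter_filter)
  also have "\<dots> = (\<Sum>e\<in>E. \<Sum>x\<in>F. if x \<in> e then 1 else 0)" by (rule sum.swap)
  also have "\<dots> = (\<Sum>e\<in>E. card {x \<in> F. x \<in> e})" 
    using assms by (simp flip: sum.inter_filter)
  also have "\<dots> = (\<Sum>e\<in>E. card (e \<inter> F))"
    by (rule sum.cong) (auto intro: arg_cong[where f=card])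
  finally show ?thesis .
qed

lemma image_degree:
  assumes "inj_on \<phi> V" "\<And>e. e \<in> E \<Longrightarrow> e \<subseteq> V" "x \<in> V"
  shows "card {e \<in> (`) \<phi> ` E. \<phi> x \<in> e} = card {e \<in> E. x \<in> e}"
proof -
  have "\<phi> x \<in> \<phi> ` e \<longleftrightarrow> x \<in> e" if "e \<in> E" for e
    using assms that by (meson inj_on_image_mem_iff)
  then have "{e \<in> (`) \<phi> ` E. \<phi> x \<in> e} = (`) \<phi> ` {e \<in> E. x \<in> e}"
    by auto
  moreover have "inj_on ((`) \<phi>) {e \<in> E. x \<in> e}"
    by (rule inj_onI) (use assms in \<open>auto simp: inj_on_image_eq_iff\<close>)
  ultimately show ?thesis by (simp add: card_image)
qed

lemma even_set_image:
  assumes "inj_on \<phi> V" "\<And>e. e \<in> E \<Longrightarrow> e \<subseteq> V" "even_set E"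
  shows "even_set ((`) \<phi> ` E)"
  unfolding even_set_def
proof (intro conjI allI)
  show "finite ((`) \<phi> ` E)" using assms by (simp add: even_set_def)
  fix y
  show "even (card {e \<in> (`) \<phi> ` E. y \<in> e})"
  proof (cases "y \<in> \<phi> ` V")
    case True
    then obtain x where "x \<in> V" "y = \<phi> x" by auto
    then show ?thesis using image_degree[OF assms(1,2)] assms(3) by (auto simp: even_set_def)
  next
    case False
    then have "{e \<in> (`) \<phi> ` E. y \<in> e} = {}" using assms(2) by auto
    then show ?thesis by (metis card.empty even_zero)
  qed
qed

lemma card_image_edges:
  assumes "inj_on \<phi> V" "\<And>e. e \<in> E \<Longrightarrow> e \<subseteq> V"
  shows "card ((`) \<phi> ` E) = card E"
  by (rule card_image, rule inj_onI) (use assms in \<open>auto simp: inj_on_image_eq_iff\<close>)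


section \<open>Letters on a ring\<close>

lemma corner_eq: "corner r = r div 4 + 1"
  unfolding corner_def by (rule Least_equality) auto

text \<open>The case \<open>r = 4\<close> is the one where the two corners \<open>i + f\<close> and \<open>i - f\<close> of a cell coincide.\<close>

locale polygon_gasket =
  fixes r :: nat
  assumes r_ge_3: "3 \<le> r" and r_neq_4: "r \<noteq> 4"
begin

text \<open>In the ring of copies, copy \<open>i\<close> is joined to copy \<open>nx i\<close>; its corner facing that copy is \<open>up i\<close>
and its corner facing the preceding copy is \<open>dn i\<close>.\<close>

definition nx :: "nat \<Rightarrow> nat" where "nx i = (i + 1) mod r"
definition up :: "nat \<Rightarrow> nat" where "up i = (i + corner r) mod r"
definition dn :: "nat \<Rightarrow> nat" where "dn i = (i + corner' r) mod r"

lemma corner_bounds: "0 < corner r" "corner r < r" "2 * corner r \<noteq> r"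
proof -
  show "0 < corner r" "corner r < r"
    using r_ge_3 by (auto simp: corner_eq)
  show "2 * corner r \<noteq> r"
    using r_ge_3 r_neq_4 unfolding corner_eq by presburger
qed

text \<open>For \<open>r > 4\<close> the number \<open>4 f\<close> lies strictly between \<open>r\<close> and \<open>2 r\<close>; for \<open>r = 3\<close> it is \<open>4\<close>.\<close>

lemma not_dvd_4_corner: "\<not> r dvd 4 * corner r"
proof
  assume "r dvd 4 * corner r"
  then obtain k where k: "4 * corner r = r * k" by (auto simp: dvd_def)
  have b: "r < 4 * corner r" "4 * corner r \<le> r + 4"
    by (auto simp: corner_eq)
  have "k \<noteq> 0" "k \<noteq> 1" using b(1) k by (auto intro: ccontr)
  then have "2 \<le> k" by simp
  then have "r * 2 \<le> r * k" by simp
  then have "r \<le> 4" using b(2) k by linarith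
  then have "r = 3" using r_ge_3 r_neq_4 by simp
  then show False using k by (simp add: corner_eq) presburger
qed

lemma nx_if: "i < r \<Longrightarrow> nx i = (if i + 1 = r then 0 else i + 1)"
  by (auto simp: nx_def)

lemma up_if: "i < r \<Longrightarrow> up i = (if i + corner r < r then i + corner r else i + corner r - r)"
  using corner_bounds by (auto simp: up_def mod_if)

lemma dn_if: "i < r \<Longrightarrow> dn i = (if i < corner r then i + r - corner r else i - corner r)"
  using corner_bounds by (auto simp: dn_def corner'_def mod_if)

lemma letter_less [simp]: "nx i < r" "up i < r" "dn i < r"
  using r_ge_3 by (auto simp: nx_def up_def dn_def)

lemma letter_neq:
  assumes "i < r"
  shows "up i \<noteq> i" "dn i \<noteq> i" "up i \<noteq> dn i" "nx i \<noteq> i" "nx (nx i) \<noteq> i"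
    using assms corner_bounds r_ge_3 by (auto simp: up_if dn_if nx_if)

lemma nx_inj: "i < r \<Longrightarrow> j < r \<Longrightarrow> nx i = nx j \<Longrightarrow> i = j"
  by (auto simp: nx_if split: if_splits)

lemma nx_surj: "j < r \<Longrightarrow> \<exists>i<r. nx i = j"
  by (rule exI[of _ "if j = 0 then r - 1 else j - 1"]) (use r_ge_3 in \<open>auto simp: nx_if\<close>)

lemma nx_funpow_mod: "i < r \<Longrightarrow> (nx ^^ k) i = (i + k) mod r"
  by (induction k) (auto simp: nx_def mod_Suc_eq)

lemma nx_funpow_less: "i < r \<Longrightarrow> (nx ^^ k) i < r"
  by (auto simp: nx_funpow_mod)

lemma up_funpow: "i < r \<Longrightarrow> up i = (nx ^^ corner r) i"
  by (simp add: nx_funpow_mod up_def)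

lemma dn_funpow: "i < r \<Longrightarrow> dn i = (nx ^^ corner' r) i"
  by (simp add: nx_funpow_mod dn_def)

lemma dn_up [simp]: "i < r \<Longrightarrow> dn (up i) = i" 
  using corner_bounds by (auto simp: up_if dn_if)

lemma up_dn [simp]: "i < r \<Longrightarrow> up (dn i) = i" 
  using corner_bounds by (auto simp: up_if dn_if)

lemma nx_reach: 
  assumes "i < r" "j < r"
  shows "\<exists>k<r. j = (nx ^^ k) i"
proof -
  have "j = (i + (if i \<le> j then j - i else j + r - i)) mod r"
    using assms by auto
  moreover have "(if i \<le> j then j - i else j + r - i) < r" using assms by auto
  ultimately show ?thesis using nx_funpow_mod[OF assms(1)] by metis
qed

lemma nx_induct:
  assumes "i < r" "P i" "\<And>k. k < r \<Longrightarrow> P k \<Longrightarrow> P (nx k)" "j < r"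
  shows "P j"
proof -
  obtain k where "j = (nx ^^ k) i" using nx_reach assms by blast
  moreover have "P ((nx ^^ k) i)"
    by (induction k) (use assms nx_funpow_less in auto)
  ultimately show ?thesis by simp
qed

definition ring_adj :: "nat \<Rightarrow> nat \<Rightarrow> bool" where
  "ring_adj i j \<longleftrightarrow> i < r \<and> j < r \<and> (j = nx i \<or> i = nx j)"

lemma ring_adj_cycle_graph: "ring_adj i j \<longleftrightarrow> (i, j) \<in> edges (cycle_graph r)"
  by (auto simp: ring_adj_def cycle_graph_def nx_def)

lemma ring_adj_sym: "ring_adj i j \<Longrightarrow> ring_adj j i"
  by (auto simp: ring_adj_def)

lemma ring_adj_irrefl: "\<not> ring_adj i i"
  using letter_neq(4) by (metis ring_adj_def)

lemma ring_adj_nx: "i < r \<Longrightarrow> ring_adj i (nx i)"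
  by (simp add: ring_adj_def)

definition rotation :: "(nat \<Rightarrow> nat) \<Rightarrow> bool" where
  "rotation \<sigma> \<longleftrightarrow> (\<forall>i<r. \<sigma> i < r \<and> \<sigma> (nx i) = nx (\<sigma> i))"

definition reflection :: "(nat \<Rightarrow> nat) \<Rightarrow> bool" where
  "reflection \<sigma> \<longleftrightarrow> (\<forall>i<r. \<sigma> i < r \<and> nx (\<sigma> (nx i)) = \<sigma> i)"

text \<open>The image of the edge \<open>{i, nx i}\<close> has a direction, and by injectivity the next edge cannot turn
back, so the direction at one edge decides the direction everywhere.\<close>

lemma rotation_or_reflection:
  assumes less: "\<And>i. i < r \<Longrightarrow> \<sigma> i < r" and inj: "inj_on \<sigma> {..<r}"
    and adj: "\<And>i j. ring_adj i j \<Longrightarrow> ring_adj (\<sigma> i) (\<sigma> j)"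
  shows "rotation \<sigma> \<or> reflection \<sigma>"
proof -
  have step: "\<sigma> (nx i) = nx (\<sigma> i) \<or> nx (\<sigma> (nx i)) = \<sigma> i" if "i < r" for i
    using adj[OF ring_adj_nx[OF that]] by (auto simp: ring_adj_def)
  have neq: "\<sigma> (nx (nx i)) \<noteq> \<sigma> i" if "i < r" for i
    using inj that letter_neq(5)[OF that] by (auto simp: inj_on_def)
  have r0: "0 < r" using r_ge_3 by simp
  show ?thesis
  proof (cases "\<sigma> (nx 0) = nx (\<sigma> 0)")
    case True
    have "\<sigma> (nx i) = nx (\<sigma> i)" if "i < r" for i
      using r0 True _ that
    proof (rule nx_induct)
      fix k assume k: "k < r" "\<sigma> (nx k) = nx (\<sigma> k)"
      have "nx (\<sigma> (nx (nx k))) \<noteq> \<sigma> (nx k)"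
      proof
        assume "nx (\<sigma> (nx (nx k))) = \<sigma> (nx k)"
        then have "\<sigma> (nx (nx k)) = \<sigma> k" using k less nx_inj by auto
        then show False using neq k by simp
      qed
      then show "\<sigma> (nx (nx k)) = nx (\<sigma> (nx k))" using step[of "nx k"] by simp
    qed
    then show ?thesis using less by (auto simp: rotation_def)
  next
    case False
    then have 0: "nx (\<sigma> (nx 0)) = \<sigma> 0" using step[OF r0] by simp
    have "nx (\<sigma> (nx i)) = \<sigma> i" if "i < r" for i
      using r0 0 _ that
    proof (rule nx_induct)
      fix k assume k: "k < r" "nx (\<sigma> (nx k)) = \<sigma> k"
      have "\<sigma> (nx (nx k)) \<noteq> nx (\<sigma> (nx k))"
        using k neq by auto
      then show "nx (\<sigma> (nx (nx k))) = \<sigma> (nx k)" using step[of "nx k"] by simp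
    qed
    then show ?thesis using less by (auto simp: reflection_def)
  qed
qed

lemma rotation_funpow: "rotation \<sigma> \<Longrightarrow> i < r \<Longrightarrow> \<sigma> ((nx ^^ k) i) = (nx ^^ k) (\<sigma> i)"
  by (induction k) (auto simp: rotation_def nx_funpow_less)

lemma reflection_funpow: "reflection \<sigma> \<Longrightarrow> i < r \<Longrightarrow> (nx ^^ k) (\<sigma> ((nx ^^ k) i)) = \<sigma> i"
proof (induction k)
  case (Suc k)
  have "(nx ^^ Suc k) (\<sigma> ((nx ^^ Suc k) i)) = (nx ^^ k) (nx (\<sigma> (nx ((nx ^^ k) i))))"
    by (simp add: funpow_swap1)
  also have "\<dots> = (nx ^^ k) (\<sigma> ((nx ^^ k) i))"
    using Suc.prems nx_funpow_less by (simp add: reflection_def)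
  finally show ?case using Suc by simp
qed simp

lemma rotation_corners:
  assumes "rotation \<sigma>" "i < r"
  shows "\<sigma> (up i) = up (\<sigma> i)" "\<sigma> (dn i) = dn (\<sigma> i)"
  using assms rotation_funpow[OF assms] by (auto simp: up_funpow dn_funpow rotation_def)

lemma reflection_corners:
  assumes "reflection \<sigma>" "i < r"
  shows "\<sigma> (up i) = dn (\<sigma> i)" "\<sigma> (dn i) = up (\<sigma> i)"
proof -
  have less: "\<sigma> j < r" if "j < r" for j using assms that by (auto simp: reflection_def)
  have "up (\<sigma> (up i)) = \<sigma> i" "dn (\<sigma> (dn i)) = \<sigma> i"
    using reflection_funpow[OF assms] assms less by (auto simp: up_funpow dn_funpow nx_funpow_less)
  then show "\<sigma> (up i) = dn (\<sigma> i)" "\<sigma> (dn i) = up (\<sigma> i)"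
    using less by (metis dn_up letter_less(2), metis up_dn letter_less(3))
qed

lemma rotation_eqI:
  assumes "rotation \<sigma>" "rotation \<tau>" "i < r" "\<sigma> i = \<tau> i" "j < r"
  shows "\<sigma> j = \<tau> j"
  using assms(3,4) _ assms(5)
  by (rule nx_induct) (use assms in \<open>auto simp: rotation_def\<close>)

lemma reflection_eqI:
  assumes "reflection \<sigma>" "reflection \<tau>" "i < r" "\<sigma> i = \<tau> i" "j < r"
  shows "\<sigma> j = \<tau> j"
  using assms(3,4) _ assms(5)
  by (rule nx_induct) (use assms nx_inj in \<open>auto simp: reflection_def\<close>)

text \<open>A rotation and a reflection that agree at two points differ there by a reflection fixing both
points, so these would be equal or antipodal; the two corners of a cell are at distance \<open>2 f\<close>, and
are neither because \<open>r\<close> does not divide \<open>4 f\<close>. This is why the corners suffice to tell dihedral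
permutations apart.\<close>

lemma rotation_reflection_disagree:
  assumes \<sigma>: "rotation \<sigma>" and \<tau>: "reflection \<tau>" and "i < r" 
    and agree: "\<sigma> (up i) = \<tau> (up i)" "\<sigma> (dn i) = \<tau> (dn i)"
  shows False
proof -
  let ?p = "\<sigma> i"
  have p: "?p < r" using assms by (auto simp: rotation_def)
  have q: "\<tau> i < r" using assms by (auto simp: reflection_def)
  have 1: "up (\<sigma> i) = dn (\<tau> i)" "dn (\<sigma> i) = up (\<tau> i)"
    using agree rotation_corners[OF \<sigma> \<open>i < r\<close>] reflection_corners[OF \<tau> \<open>i < r\<close>] by auto
  then have "\<tau> i = up (up ?p)" using q up_dn by metis
  then have "up (up (up (up ?p))) = ?p" using 1 p q by (metis letter_less(2) up_dn)
  then have "(?p + (corner r + corner r + corner r + corner r)) mod r = ?p mod r"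
    using p by (simp add: up_def mod_simps add.assoc)
  then have "r dvd (?p + (corner r + corner r + corner r + corner r)) - ?p"
    by (subst (asm) mod_eq_dvd_iff_nat) simp_all
  moreover have "(?p + (corner r + corner r + corner r + corner r)) - ?p = 4 * corner r" by simp
  ultimately have "r dvd 4 * corner r" by metis
  then show False using not_dvd_4_corner by simp
qed

lemma dihedral_iff:
  "\<sigma> \<in> dihedral r \<longleftrightarrow> (\<sigma> permutes {..<r} \<and> (rotation \<sigma> \<or> reflection \<sigma>))"
proof
  assume "\<sigma> \<in> dihedral r"
  then have p: "\<sigma> permutes {..<r}" and g: "graph_isomorphism \<sigma> (cycle_graph r) (cycle_graph r)"
    by (auto simp: dihedral_def)
  have less: "\<sigma> i < r" if "i < r" for i using permutes_in_image[OF p, of i] that by auto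
  have "rotation \<sigma> \<or> reflection \<sigma>"
  proof (rule rotation_or_reflection)
    fix i j assume "ring_adj i j"
    then show "ring_adj (\<sigma> i) (\<sigma> j)"
      using g unfolding graph_isomorphism_def ring_adj_cycle_graph by (auto simp: cycle_graph_def)
  qed (use less permutes_inj_on[OF p] in auto)
  then show "\<sigma> permutes {..<r} \<and> (rotation \<sigma> \<or> reflection \<sigma>)" using p by simp
next
  assume a: "\<sigma> permutes {..<r} \<and> (rotation \<sigma> \<or> reflection \<sigma>)"
  then have inj: "\<sigma> i = \<sigma> j \<longleftrightarrow> i = j" for i j by (metis permutes_inj injD)
  have less: "\<sigma> i < r" if "i < r" for i using permutes_in_image[of \<sigma> "{..<r}" i] a that by auto
  have "ring_adj i j \<longleftrightarrow> ring_adj (\<sigma> i) (\<sigma> j)" if "i < r" "j < r" for i j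
  proof (cases "rotation \<sigma>")
    case True
    then have "nx (\<sigma> i) = \<sigma> (nx i)" "nx (\<sigma> j) = \<sigma> (nx j)" using that by (auto simp: rotation_def)
    then show ?thesis using that less by (auto simp: ring_adj_def inj)
  next
    case False
    then have "reflection \<sigma>" using a by simp
    then have "nx (\<sigma> (nx i)) = \<sigma> i" "nx (\<sigma> (nx j)) = \<sigma> j" using that by (auto simp: reflection_def)
    then show ?thesis using that less unfolding ring_adj_def 
      by (metis inj letter_less(1) nx_inj)
  qed
  moreover have "bij_betw \<sigma> {..<r} {..<r}" using a permutes_imp_bij by blast
  ultimately show "\<sigma> \<in> dihedral r"
    using a unfolding dihedral_def graph_isomorphism_def ring_adj_cycle_graph 
    by (auto simp: cycle_graph_def)
qed

end

section \<open>The address graph\<close>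

definition tail :: "(nat \<Rightarrow> nat) \<Rightarrow> nat \<Rightarrow> nat" where "tail x = (\<lambda>n. x (Suc n))"

definition cons :: "nat \<Rightarrow> (nat \<Rightarrow> nat) \<Rightarrow> nat \<Rightarrow> nat" where
  "cons i u = (\<lambda>n. case n of 0 \<Rightarrow> i | Suc k \<Rightarrow> u k)"

lemma cons_simps [simp]: "cons i u 0 = i" "cons i u (Suc n) = u n" "tail (cons i u) = u" 
  by (auto simp: cons_def tail_def)

lemma tail_apply [simp]: "tail x n = x (Suc n)" by (simp add: tail_def)

lemma cons_head_tail [simp]: "cons (x 0) (tail x) = x"
  by (rule ext) (auto simp: cons_def split: nat.splits)

lemma cons_eq_iff [simp]: "cons i u = cons j v \<longleftrightarrow> i = j \<and> u = v"
  by (metis cons_simps(1,3))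

lemma seq_eqI: "x 0 = y 0 \<Longrightarrow> tail x = tail y \<Longrightarrow> x = y"
  by (metis cons_head_tail)

context polygon_gasket
begin

definition seqs :: "(nat \<Rightarrow> nat) set" where "seqs = {x. \<forall>n. x n < r}"

lemma seqsD: "x \<in> seqs \<Longrightarrow> x n < r" by (simp add: seqs_def)

lemma tail_seqs [simp]: "x \<in> seqs \<Longrightarrow> tail x \<in> seqs" by (simp add: seqs_def)

lemma cons_seqs [simp]: "cons i u \<in> seqs \<longleftrightarrow> i < r \<and> u \<in> seqs"
  by (auto simp: seqs_def cons_def split: nat.splits)

text \<open>Adjacency inside a cell: the tail names the cell, the first letter the position in it.\<close>

definition cell_adj :: "(nat \<Rightarrow> nat) \<Rightarrow> (nat \<Rightarrow> nat) \<Rightarrow> bool" where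
  "cell_adj x y \<longleftrightarrow> x \<in> seqs \<and> y \<in> seqs \<and> tail x = tail y \<and> ring_adj (x 0) (y 0)"

text \<open>The gluing rule for infinite words: \<open>m\<close> is the length of the initial run of corner letters and
\<open>i\<close> the letter after it.\<close>

definition glue_at :: "nat \<Rightarrow> nat \<Rightarrow> (nat \<Rightarrow> nat) \<Rightarrow> (nat \<Rightarrow> nat) \<Rightarrow> bool" where
  "glue_at m i x y \<longleftrightarrow> 1 \<le> m \<and> i < r \<and> (\<forall>n<m. x n = up i \<and> y n = dn (nx i)) \<and>
     x m = i \<and> y m = nx i \<and> (\<forall>n>m. x n = y n)"

definition link :: "(nat \<Rightarrow> nat) \<Rightarrow> (nat \<Rightarrow> nat) \<Rightarrow> bool" where
  "link x y \<longleftrightarrow> x \<in> seqs \<and> y \<in> seqs \<and> (\<exists>m i. glue_at m i x y \<or> glue_at m i y x)"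

lemma cell_adj_sym: "cell_adj x y \<Longrightarrow> cell_adj y x"
  by (auto simp: cell_adj_def intro: ring_adj_sym)

lemma link_sym: "link x y \<Longrightarrow> link y x"
  by (auto simp: link_def)

lemma cell_adj_neq: "cell_adj x y \<Longrightarrow> x \<noteq> y"
  using ring_adj_irrefl by (auto simp: cell_adj_def)

lemma cell_adj_cons: "cell_adj (cons i u) (cons j v) \<longleftrightarrow> u \<in> seqs \<and> u = v \<and> ring_adj i j"
  by (auto simp: cell_adj_def ring_adj_def)

text \<open>Corner letters differ from the letter of the copy, so \<open>m\<close> can be read off from a single word. This
is what makes linking a partial matching.\<close>

lemma glue_at_first_change:
  assumes "glue_at m i x y \<or> glue_at m i y x"
  shows "(LEAST n. x n \<noteq> x 0) = m"
proof (rule Least_equality)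
  have *: "x m = i \<and> x 0 = up i \<or> x m = nx i \<and> x 0 = dn (nx i)" "i < r"
    using assms by (auto simp: glue_at_def)
  then show "x m \<noteq> x 0" using letter_neq(1)[of i] letter_neq(2)[of "nx i"] by (metis letter_less(1))
  fix n assume "x n \<noteq> x 0"
  show "m \<le> n"
  proof (rule ccontr)
    assume "\<not> m \<le> n"
    then have "n < m" "0 < m" by auto
    then have "x n = x 0" using assms unfolding glue_at_def by metis
    then show False using \<open>x n \<noteq> x 0\<close> by simp
  qed
qed

lemma glue_at_cases:
  assumes "glue_at m i x y \<or> glue_at m i y x" "glue_at n j x z \<or> glue_at n j z x"
  shows "(glue_at m i x y \<and> glue_at m i x z) \<or> (glue_at m i y x \<and> glue_at m i z x)"
proof -
  have [simp]: "n = m" using glue_at_first_change[OF assms(1)] glue_at_first_change[OF assms(2)] by simp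
  have "1 \<le> m" "i < r" "j < r" using assms by (auto simp: glue_at_def)
  then have pos: "0 < m" by simp
  have g1: "x m = i \<and> x 0 = up i" if "glue_at m i x y" for i y using that pos by (auto simp: glue_at_def)
  have g2: "x m = nx i \<and> x 0 = dn (nx i)" if "glue_at m i y x" for i y using that pos by (auto simp: glue_at_def)
  consider "glue_at m i x y" "glue_at m j x z" | "glue_at m i x y" "glue_at m j z x"
    | "glue_at m i y x" "glue_at m j x z" | "glue_at m i y x" "glue_at m j z x"
    using assms by auto
  then show ?thesis
  proof cases
    case 1 then show ?thesis using g1 by metis
  next
    case 2 then show ?thesis using g1 g2 letter_neq(3)[OF \<open>i < r\<close>] by metis
  next
    case 3 then show ?thesis using g1 g2 letter_neq(3)[OF \<open>j < r\<close>] by metis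
  next
    case 4 then show ?thesis using g2 nx_inj[OF \<open>i < r\<close> \<open>j < r\<close>] by metis
  qed
qed

lemma glue_at_unique:
  assumes "glue_at m i x y" "glue_at m i x z" shows "y = z"
proof
  fix n show "y n = z n" using assms by (cases n m rule: linorder_cases) (auto simp: glue_at_def)
qed

lemma glue_at_unique':
  assumes "glue_at m i y x" "glue_at m i z x" shows "y = z"
proof
  fix n show "y n = z n" using assms by (cases n m rule: linorder_cases) (auto simp: glue_at_def)
qed

text \<open>A word determines \<open>m\<close>, \<open>i\<close> and, since \<open>up i \<noteq> dn i\<close>, the side on which it is glued. So a point
of the gasket has at most two addresses.\<close>

lemma link_unique: "link x y \<Longrightarrow> link x z \<Longrightarrow> y = z"
  unfolding link_def using glue_at_cases glue_at_unique glue_at_unique' by metis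

lemma link_tail_neq: "link x y \<Longrightarrow> tail x \<noteq> tail y"
proof
  assume "link x y" and t: "tail x = tail y"
  then obtain m i where g: "glue_at m i x y \<or> glue_at m i y x" by (auto simp: link_def)
  then obtain k where "m = Suc k" by (cases m) (auto simp: glue_at_def)
  then have "x m = y m" using fun_cong[OF t, of k] by simp
  moreover have "i < r" "x m = i \<and> y m = nx i \<or> y m = i \<and> x m = nx i" using g by (auto simp: glue_at_def)
  ultimately show False using letter_neq(4)[of i] by metis
qed

lemma link_neq: "link x y \<Longrightarrow> x \<noteq> y" using link_tail_neq by blast

lemma link_not_cell_adj: "link x y \<Longrightarrow> \<not> cell_adj x y"
  using link_tail_neq by (auto simp: cell_adj_def)

text \<open>Adjacency in the address graph, whose quotient by links is the gasket.\<close>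

definition hadj :: "(nat \<Rightarrow> nat) \<Rightarrow> (nat \<Rightarrow> nat) \<Rightarrow> bool" where
  "hadj x y \<longleftrightarrow> cell_adj x y \<or> link x y"

lemma hadj_sym: "hadj x y \<Longrightarrow> hadj y x"
  using cell_adj_sym link_sym by (auto simp: hadj_def)

lemma hadj_neq: "hadj x y \<Longrightarrow> x \<noteq> y"
  using cell_adj_neq link_neq by (auto simp: hadj_def)

lemma hadj_seqs: "hadj x y \<Longrightarrow> x \<in> seqs \<and> y \<in> seqs"
  by (auto simp: hadj_def link_def cell_adj_def)

lemma glue_at_tail: 
  assumes "glue_at m i x y" "x \<in> seqs" "y \<in> seqs"
  shows "m = 1 \<and> cell_adj (tail x) (tail y) \<and> x 1 = i \<and> y 1 = nx i \<or> (1 < m \<and> glue_at (m - 1) i (tail x) (tail y))"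
proof (cases "m = 1")
  case True
  then have "tail (tail x) = tail (tail y)" using assms by (auto simp: glue_at_def fun_eq_iff)
  then show ?thesis using assms True by (auto simp: glue_at_def cell_adj_def ring_adj_def)
next
  case False
  then show ?thesis using assms by (auto simp: glue_at_def)
qed

text \<open>Self-similarity: a link with \<open>m = 1\<close> joins neighbouring cells of one ring, whose tails are adjacent
in a cell one level up; a longer run just loses a letter.\<close>

lemma link_tail: "link x y \<Longrightarrow> hadj (tail x) (tail y)"
  unfolding link_def hadj_def using glue_at_tail cell_adj_sym tail_seqs by metis

lemma glue_at_cons:
  assumes "u \<in> seqs" "v \<in> seqs" "i < r" "u 0 = i" "v 0 = nx i" "tail u = tail v"
  shows "glue_at 1 i (cons (up i) u) (cons (dn (nx i)) v)"
proof -
  have "u n = v n" if "0 < n" for n using that fun_cong[OF assms(6), of "n - 1"] by (cases n) auto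
  then show ?thesis using assms by (auto simp: glue_at_def cons_def split: nat.splits)
qed

lemma glue_at_cons_Suc:
  assumes "glue_at m i u v"
  shows "glue_at (Suc m) i (cons (up i) u) (cons (dn (nx i)) v)"
  using assms by (auto simp: glue_at_def cons_def split: nat.splits)

text \<open>Conversely every edge of the address graph arises from a link one level down: prepend the two corner
letters.\<close>

lemma hadj_lift: 
  assumes "hadj u v" shows "\<exists>i j. link (cons i u) (cons j v)"
proof -
  have s: "u \<in> seqs" "v \<in> seqs" using hadj_seqs[OF assms] by auto
  have "\<exists>m i. glue_at m i (cons (up i) u) (cons (dn (nx i)) v) \<or> glue_at m i (cons (up i) v) (cons (dn (nx i)) u)"
    using assms unfolding hadj_def
  proof
    assume "cell_adj u v"
    then show ?thesis 
      using glue_at_cons[OF s, of "u 0"] glue_at_cons[OF s(2,1), of "v 0"] seqsD s unfolding cell_adj_def ring_adj_def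
      by metis
  next
    assume "link u v"
    then show ?thesis unfolding link_def using glue_at_cons_Suc by metis
  qed
  then show ?thesis unfolding link_def using s by (metis cons_seqs letter_less(2,3))
qed

text \<open>The position \<open>m \<ge> 1\<close> is the last place where two linked words differ, hence visible in the tails,
and so are the letters there; they determine the corner letters. The only danger, a link running in
the opposite direction, would need \<open>nx (nx i) = i\<close>.\<close>

lemma link_determined_by_tails:
  assumes "link x y" "link x' y'" "tail x = tail x'" "tail y = tail y'"
  shows "x = x'"
proof -
  obtain m i where g: "glue_at m i x y \<or> glue_at m i y x" using assms by (auto simp: link_def)
  obtain n j where g': "glue_at n j x' y' \<or> glue_at n j y' x'" using assms by (auto simp: link_def)
  have eq: "x n = x' n" "y n = y' n" if "0 < n" for n
    using that fun_cong[OF assms(3), of "n - 1"] fun_cong[OF assms(4), of "n - 1"] by auto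
  have ij: "i < r" "j < r" "1 \<le> m" "1 \<le> n" using g g' by (auto simp: glue_at_def)
  have "m = n"
  proof (rule ccontr)
    assume "m \<noteq> n"
    then consider "m < n" | "n < m" by linarith
    then show False
    proof cases
      case 1
      then have "x n = y n" using g unfolding glue_at_def by metis
      then have "x' n = y' n" using eq ij by simp
      moreover have "x' n = j \<and> y' n = nx j \<or> y' n = j \<and> x' n = nx j" using g' by (auto simp: glue_at_def)
      ultimately show ?thesis using letter_neq(4)[OF ij(2)] by metis
    next
      case 2
      then have "x' m = y' m" using g' unfolding glue_at_def by metis
      then have "x m = y m" using eq ij by simp
      moreover have "x m = i \<and> y m = nx i \<or> y m = i \<and> x m = nx i" using g by (auto simp: glue_at_def)
      ultimately show ?thesis using letter_neq(4)[OF ij(1)] by metis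
    qed
  qed
  have "x m = x' m" "y m = y' m" using eq ij by auto
  consider "glue_at m i x y" "glue_at m j x' y'" | "glue_at m i x y" "glue_at m j y' x'"
    | "glue_at m i y x" "glue_at m j x' y'" | "glue_at m i y x" "glue_at m j y' x'"
    using g g' \<open>m = n\<close> by auto
  then have "x 0 = x' 0"
  proof cases
    case 1 
    then have "i = j" using \<open>x m = x' m\<close> by (auto simp: glue_at_def)
    then show ?thesis using 1 by (auto simp: glue_at_def)
  next
    case 2 
    then have "i = nx j" "j = nx i" using \<open>x m = x' m\<close> \<open>y m = y' m\<close> by (auto simp: glue_at_def)
    then show ?thesis using letter_neq(5)[OF ij(1)] by metis
  next
    case 3 
    then have "i = nx j" "j = nx i" using \<open>x m = x' m\<close> \<open>y m = y' m\<close> by (auto simp: glue_at_def)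
    then show ?thesis using letter_neq(5)[OF ij(1)] by metis
  next
    case 4
    then have "i = j" using \<open>x m = x' m\<close> \<open>y m = y' m\<close> by (auto simp: glue_at_def)
    then show ?thesis using 4 by (auto simp: glue_at_def)
  qed
  then show ?thesis using assms(3) by (rule seq_eqI)
qed

lemma link_over_cell:
  assumes "link x y" "cell_adj (tail x) (tail y)"
  shows "(x 0 = up (x 1) \<and> y 1 = nx (x 1)) \<or> (x 0 = dn (x 1) \<and> x 1 = nx (y 1))"
proof -
  obtain m i where g: "glue_at m i x y \<or> glue_at m i y x" and s: "x \<in> seqs" "y \<in> seqs" 
    using assms by (auto simp: link_def)
  have "\<not> glue_at k i (tail x) (tail y)" "\<not> glue_at k i (tail y) (tail x)" for k
    using assms(2) link_not_cell_adj s unfolding link_def by (meson tail_seqs)+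
  then have "m = 1" using g glue_at_tail s by metis
  then show ?thesis using g unfolding glue_at_def by (metis less_one)
qed

end

section \<open>Short even edge sets of the address graph are cells\<close>

context polygon_gasket
begin

definition cell_edges :: "(nat \<Rightarrow> nat) set set" where
  "cell_edges = {{x, y} | x y. cell_adj x y}"

definition link_edges :: "(nat \<Rightarrow> nat) set set" where
  "link_edges = {{x, y} | x y. link x y}"

definition ring_edge :: "(nat \<Rightarrow> nat) \<Rightarrow> nat \<Rightarrow> (nat \<Rightarrow> nat) set" where
  "ring_edge u i = {cons i u, cons (nx i) u}"

definition ring :: "(nat \<Rightarrow> nat) \<Rightarrow> (nat \<Rightarrow> nat) set set" where
  "ring u = ring_edge u ` {..<r}"

lemma cell_adjE:
  assumes "cell_adj x y"
  obtains u i j where "x = cons i u" "y = cons j u" "u \<in> seqs" "ring_adj i j"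
  using assms cons_head_tail[of x] cons_head_tail[of y] tail_seqs unfolding cell_adj_def by metis

lemma cell_edges_iff: "e \<in> cell_edges \<longleftrightarrow> (\<exists>u\<in>seqs. \<exists>i<r. e = ring_edge u i)"
proof
  assume "e \<in> cell_edges"
  then obtain x y where e: "e = {x, y}" and a: "cell_adj x y" by (auto simp: cell_edges_def)
  then obtain u i j where "x = cons i u" "y = cons j u" "u \<in> seqs" "ring_adj i j"
    by (elim cell_adjE)
  then show "\<exists>u\<in>seqs. \<exists>i<r. e = ring_edge u i"
    unfolding e ring_adj_def ring_edge_def by (metis insert_commute)
next
  assume "\<exists>u\<in>seqs. \<exists>i<r. e = ring_edge u i"
  then obtain u i where "u \<in> seqs" "i < r" "e = ring_edge u i" by auto
  moreover from this have "cell_adj (cons i u) (cons (nx i) u)"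
    by (simp add: cell_adj_cons ring_adj_nx)
  ultimately show "e \<in> cell_edges" unfolding cell_edges_def ring_edge_def by blast
qed

lemma ring_subset_cell_edges: "u \<in> seqs \<Longrightarrow> ring u \<subseteq> cell_edges"
  by (auto simp: ring_def) (use cell_edges_iff in blast)

lemma cell_adj_in_ring: 
  assumes "cell_adj x y" shows "{x, y} \<in> ring (tail x)"
proof -
  from assms obtain u i j where xy: "x = cons i u" "y = cons j u" "ring_adj i j"
    by (elim cell_adjE)
  then have "i < r" "j < r" "{x, y} = ring_edge u i \<or> {x, y} = ring_edge u j"
    by (auto simp: ring_adj_def ring_edge_def)
  then show ?thesis using xy by (auto simp: ring_def)
qed

lemma ring_edge_inj: "i < r \<Longrightarrow> j < r \<Longrightarrow> ring_edge u i = ring_edge v j \<longleftrightarrow> i = j \<and> u = v"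
  unfolding ring_edge_def doubleton_eq_iff using letter_neq(5) by auto

lemma card_ring: "card (ring u) = r"
  unfolding ring_def by (subst card_image) (auto simp: inj_on_def ring_edge_inj)

lemma finite_ring [simp]: "finite (ring u)" by (simp add: ring_def)

lemma cell_edges_at:
  assumes "e \<in> cell_edges" "cons (nx i) u \<in> e" "i < r"
  shows "e = ring_edge u i \<or> e = ring_edge u (nx i)"
proof -
  obtain v j where "j < r" "e = ring_edge v j" using assms cell_edges_iff by auto
  then show ?thesis using assms nx_inj[of i j] by (auto simp: ring_edge_def)
qed

lemma even_ring: 
  assumes "u \<in> seqs" shows "even_set (ring u)"
  unfolding even_set_def
proof (intro conjI allI)
  fix x
  show "even (card {e \<in> ring u. x \<in> e})"
  proof (cases "\<exists>i<r. x = cons (nx i) u")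
    case True
    then obtain i where i: "i < r" "x = cons (nx i) u" by auto
    have "e = ring_edge u i \<or> e = ring_edge u (nx i)" if "e \<in> ring u" "x \<in> e" for e
      using cell_edges_at[of e i u] that i ring_subset_cell_edges[OF assms] by blast
    moreover have "ring_edge u i \<in> ring u" "ring_edge u (nx i) \<in> ring u"
      "x \<in> ring_edge u i" "x \<in> ring_edge u (nx i)"
      using i by (auto simp: ring_def ring_edge_def)
    ultimately have "{e \<in> ring u. x \<in> e} = {ring_edge u i, ring_edge u (nx i)}" by blast
    moreover have "ring_edge u i \<noteq> ring_edge u (nx i)"
      using i letter_neq(4)[of i] ring_edge_inj by auto
    ultimately show ?thesis by simp
  next
    case False
    then have "x \<noteq> cons i u" if "i < r" for i using nx_surj that by metis
    then have "{e \<in> ring u. x \<in> e} = {}" unfolding ring_def ring_edge_def using letter_less(1) by blast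
    then show ?thesis by (metis card.empty even_zero)
  qed
qed simp

text \<open>A vertex has only two cell edges, so an even set of cell edges that contains one of them contains
the other, and the edges propagate around the cell.\<close>

lemma even_cell_edges_contain_ring:
  assumes "E \<subseteq> cell_edges" "even_set E" "E \<noteq> {}"
  shows "\<exists>u\<in>seqs. ring u \<subseteq> E"
proof -
  obtain u i where u: "u \<in> seqs" and i: "i < r" "ring_edge u i \<in> E"
    using assms cell_edges_iff by (metis equals0I subsetD)
  have "ring_edge u j \<in> E" if "j < r" for j
    using i _ that
  proof (rule nx_induct)
    fix k assume k: "k < r" "ring_edge u k \<in> E"
    let ?x = "cons (nx k) u"
    have "{e \<in> E. ?x \<in> e} \<noteq> {ring_edge u k}"
      using assms(2) by (metis even_set_def card_1_singleton_iff One_nat_def odd_one)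
    moreover have "ring_edge u k \<in> {e \<in> E. ?x \<in> e}" using k by (simp add: ring_edge_def)
    ultimately obtain e where "e \<in> E" "?x \<in> e" "e \<noteq> ring_edge u k" by blast
    then show "ring_edge u (nx k) \<in> E" using cell_edges_at[OF _ _ k(1)] assms(1) by blast
  qed
  then show ?thesis using u by (auto simp: ring_def)
qed

lemma link_edges_at: "e \<in> link_edges \<Longrightarrow> f \<in> link_edges \<Longrightarrow> x \<in> e \<Longrightarrow> x \<in> f \<Longrightarrow> e = f"
  by (auto simp: link_edges_def) (use link_unique link_sym in metis)+

text \<open>Distinct link edges stay distinct when their cells are contracted, so contraction does not merge
edges and parities can be counted.\<close>

lemma inj_on_contract_link_edges: "inj_on ((`) tail) link_edges"
proof (rule inj_onI)
  fix e f assume "e \<in> link_edges" "f \<in> link_edges" and t: "tail ` e = tail ` f"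
  then obtain x y x' y' where e: "e = {x, y}" "link x y" and f: "f = {x', y'}" "link x' y'"
    by (auto simp: link_edges_def)
  have l: "link y x" "link y' x'" using e f link_sym by auto
  from t have "tail x = tail x' \<and> tail y = tail y' \<or> tail x = tail y' \<and> tail y = tail x'"
    by (auto simp: e f doubleton_eq_iff)
  then show "e = f"
  proof
    assume "tail x = tail x' \<and> tail y = tail y'"
    then have "x = x'" "y = y'" using link_determined_by_tails e f l by blast+
    then show ?thesis by (simp add: e f)
  next
    assume "tail x = tail y' \<and> tail y = tail x'"
    then have "x = y'" "y = x'" using link_determined_by_tails e f l by blast+
    then show ?thesis by (simp add: e f insert_commute)
  qed
qed

lemma contract_link_edges: "e \<in> link_edges \<Longrightarrow> tail ` e \<in> cell_edges \<union> link_edges"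
proof -
  assume "e \<in> link_edges"
  then obtain x y where "e = {x, y}" "link x y" by (auto simp: link_edges_def)
  then have "tail ` e = {tail x, tail y}" "hadj (tail x) (tail y)" using link_tail by auto
  then show ?thesis unfolding link_edges_def cell_edges_def hadj_def by blast
qed

lemma cell_edge_meets_fibre:
  assumes "e \<in> cell_edges" shows "even (card (e \<inter> {x. tail x = u}))"
proof -
  obtain v i where e: "i < r" "e = ring_edge v i" using assms cell_edges_iff by auto
  then have "e \<inter> {x. tail x = u} = (if u = v then e else {})" by (auto simp: ring_edge_def)
  moreover have "card e = 2" using e letter_neq(4)[of i] by (simp add: ring_edge_def)
  ultimately show ?thesis by simp
qed

lemma link_edge_meets_fibre:
  assumes "e \<in> link_edges" shows "card (e \<inter> {x. tail x = u}) = (if u \<in> tail ` e then 1 else 0)"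
proof -
  obtain x y where e: "e = {x, y}" "tail x \<noteq> tail y" 
    using assms link_tail_neq by (auto simp: link_edges_def)
  then have "e \<inter> {x. tail x = u} = (if tail x = u then {x} else if tail y = u then {y} else {})"
    by auto
  then show ?thesis using e by auto
qed

text \<open>Sum the degrees over a cell: cell edges contribute zero or two, link edges contribute one exactly if
they leave this cell, because no link joins two vertices of one cell.\<close>

lemma even_contract:
  assumes E: "E \<subseteq> cell_edges \<union> link_edges" "even_set E"
  shows "even_set ((`) tail ` (E \<inter> link_edges))"
  unfolding even_set_def
proof (intro conjI allI)
  have fin: "finite E" using E by (simp add: even_set_def)
  then show "finite ((`) tail ` (E \<inter> link_edges))" by simp
  fix u
  let ?F = "\<Union>E \<inter> {x. tail x = u}"
  have fe: "finite e" if "e \<in> E" for e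
    using that E(1) by (auto simp: cell_edges_def link_edges_def)
  then have finF: "finite ?F" using fin by auto
  have "even (\<Sum>x\<in>?F. card {e \<in> E. x \<in> e})"
    using E(2) by (intro dvd_sum) (auto simp: even_set_def)
  also have "(\<Sum>x\<in>?F. card {e \<in> E. x \<in> e}) = (\<Sum>e\<in>E. card (e \<inter> ?F))"
    using handshake[OF fin finF] .
  also have "\<dots> = (\<Sum>e\<in>E. card (e \<inter> {x. tail x = u}))"
    by (rule sum.cong) (auto intro: arg_cong[where f=card])
  also have "\<dots> = (\<Sum>e\<in>E - link_edges. card (e \<inter> {x. tail x = u})) + (\<Sum>e\<in>E \<inter> link_edges. card (e \<inter> {x. tail x = u}))"
    using sum.Int_Diff[OF fin, of _ link_edges] by (simp add: add.commute)
  also have "(\<Sum>e\<in>E \<inter> link_edges. card (e \<inter> {x. tail x = u})) = (\<Sum>e\<in>E \<inter> link_edges. if u \<in> tail ` e then 1 else 0)"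
    by (rule sum.cong) (auto simp: link_edge_meets_fibre)
  also have "\<dots> = card {e \<in> E \<inter> link_edges. u \<in> tail ` e}"
    using fin by (simp flip: sum.inter_filter)
  finally have "even ((\<Sum>e\<in>E - link_edges. card (e \<inter> {x. tail x = u})) + card {e \<in> E \<inter> link_edges. u \<in> tail ` e})" .
  moreover have "even (\<Sum>e\<in>E - link_edges. card (e \<inter> {x. tail x = u}))"
    using E(1) by (intro dvd_sum) (auto intro: cell_edge_meets_fibre)
  ultimately have "even (card {e \<in> E \<inter> link_edges. u \<in> tail ` e})" by simp
  moreover have "{e' \<in> (`) tail ` (E \<inter> link_edges). u \<in> e'} = (`) tail ` {e \<in> E \<inter> link_edges. u \<in> tail ` e}"
    by auto
  moreover have "card ((`) tail ` {e \<in> E \<inter> link_edges. u \<in> tail ` e}) = card {e \<in> E \<inter> link_edges. u \<in> tail ` e}"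
    by (rule card_image, rule inj_on_subset[OF inj_on_contract_link_edges]) auto
  ultimately show "even (card {e' \<in> (`) tail ` (E \<inter> link_edges). u \<in> e'})" by simp
qed

text \<open>Links form a matching, so each end point of a link would have degree one.\<close>

lemma even_not_only_links:
  assumes "E \<subseteq> link_edges" "even_set E" shows "E = {}"
proof (rule ccontr)
  assume "E \<noteq> {}"
  then obtain e where e: "e \<in> E" by auto
  then obtain x where x: "x \<in> e" using assms(1) by (auto simp: link_edges_def)
  have "{f \<in> E. x \<in> f} = {e}" using link_edges_at assms(1) e x by blast
  then show False using assms(2) by (metis even_set_def card_1_singleton_iff One_nat_def odd_one)
qed

text \<open>The even sets without link edges contain a cell. Any other one contains cell edges as well, since
links alone are never even, so that it becomes strictly smaller, but not empty, by contraction; the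
induction hypothesis then gives more than \<open>r\<close> edges.\<close>

theorem even_set_girth:
  assumes "E \<subseteq> cell_edges \<union> link_edges" "even_set E" "E \<noteq> {}"
  shows "r \<le> card E \<and> (card E = r \<longrightarrow> (\<exists>u\<in>seqs. E = ring u))"
  using assms
proof (induction "card E" arbitrary: E rule: less_induct)
  case (less E)
  have fin: "finite E" using less by (simp add: even_set_def)
  show ?case
  proof (cases "E \<inter> link_edges = {}")
    case True
    then have "E \<subseteq> cell_edges" using less by auto
    then obtain u where u: "u \<in> seqs" "ring u \<subseteq> E"
      using even_cell_edges_contain_ring less by blast
    then show ?thesis using fin card_ring card_mono card_subset_eq by metis
  next
    case False
    let ?E' = "(`) tail ` (E \<inter> link_edges)"
    have c: "card ?E' = card (E \<inter> link_edges)"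
      by (rule card_image, rule inj_on_subset[OF inj_on_contract_link_edges]) auto
    have "E \<inter> link_edges \<noteq> E" using even_not_only_links less by auto
    then have lt: "card ?E' < card E" unfolding c using fin by (intro psubset_card_mono) auto
    moreover have "r \<le> card ?E'"
      using less(1)[OF lt] contract_link_edges even_contract less False by blast
    ultimately show ?thesis by simp
  qed
qed

end

section \<open>Isomorphisms of address graphs act letterwise\<close>

lemma cofinal_refl: "cofinal_seqs x x" by (simp add: cofinal_seqs_def)

lemma cofinal_sym: "cofinal_seqs x y \<Longrightarrow> cofinal_seqs y x" unfolding cofinal_seqs_def by metis

lemma cofinal_trans: "cofinal_seqs x y \<Longrightarrow> cofinal_seqs y z \<Longrightarrow> cofinal_seqs x z"
  unfolding cofinal_seqs_def by (metis le_trans linear)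

lemma cofinal_tail: "cofinal_seqs x y \<longleftrightarrow> cofinal_seqs (tail x) (tail y)"
proof
  assume "cofinal_seqs x y"
  then show "cofinal_seqs (tail x) (tail y)" unfolding cofinal_seqs_def tail_apply
    by (metis le_SucI)
next
  assume "cofinal_seqs (tail x) (tail y)"
  then obtain N where N: "x (Suc n) = y (Suc n)" if "N \<le> n" for n by (auto simp: cofinal_seqs_def)
  have "x n = y n" if "Suc N \<le> n" for n using N[of "n - 1"] that by simp
  then show "cofinal_seqs x y" unfolding cofinal_seqs_def by blast
qed

context polygon_gasket
begin

text \<open>The addresses of the points of one limit graph.\<close>

definition cofinality_class :: "(nat \<Rightarrow> nat) \<Rightarrow> (nat \<Rightarrow> nat) set" where
  "cofinality_class \<xi> = {x \<in> seqs. cofinal_seqs x \<xi>}"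

lemma class_seqs: "x \<in> cofinality_class \<xi> \<Longrightarrow> x \<in> seqs" by (simp add: cofinality_class_def)

lemma class_tail: "x \<in> cofinality_class \<xi> \<Longrightarrow> tail x \<in> cofinality_class (tail \<xi>)"
  using cofinal_tail by (auto simp: cofinality_class_def)

lemma class_cons: "i < r \<Longrightarrow> u \<in> cofinality_class (tail \<xi>) \<Longrightarrow> cons i u \<in> cofinality_class \<xi>"
  using cofinal_tail[of "cons i u" \<xi>] by (simp add: cofinality_class_def)

lemma hadj_cofinal: 
  assumes "hadj x y" shows "cofinal_seqs x y"
proof -
  have "cofinal_seqs x y" if "tail x = tail y" for x y
    by (subst cofinal_tail) (simp add: that cofinal_refl)
  moreover have "cofinal_seqs x y" if "glue_at m i x y" for m i x y
    using that unfolding glue_at_def cofinal_seqs_def by (metis Suc_le_lessD)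
  ultimately show ?thesis using assms cofinal_sym unfolding hadj_def cell_adj_def link_def by metis
qed

lemma class_hadj: "x \<in> cofinality_class \<xi> \<Longrightarrow> hadj x y \<Longrightarrow> y \<in> cofinality_class \<xi>"
  using hadj_cofinal hadj_seqs cofinal_sym cofinal_trans unfolding cofinality_class_def by blast

lemma hadj_edge_iff: "{x, y} \<in> cell_edges \<union> link_edges \<longleftrightarrow> hadj x y"
proof
  assume "{x, y} \<in> cell_edges \<union> link_edges"
  then obtain a b where "{x, y} = {a, b}" "hadj a b" by (auto simp: cell_edges_def link_edges_def hadj_def)
  then show "hadj x y" using hadj_sym by (auto simp: doubleton_eq_iff)
qed (auto simp: cell_edges_def link_edges_def hadj_def)

lemma hadj_edgeE:
  assumes "e \<in> cell_edges \<union> link_edges" obtains x y where "e = {x, y}" "hadj x y"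
  using assms by (auto simp: cell_edges_def link_edges_def hadj_def)

text \<open>The inverse is carried along, so that every statement about isomorphisms can be used in both
directions.\<close>

definition address_iso ::
    "(nat \<Rightarrow> nat) \<Rightarrow> (nat \<Rightarrow> nat) \<Rightarrow> ((nat \<Rightarrow> nat) \<Rightarrow> nat \<Rightarrow> nat) \<Rightarrow> ((nat \<Rightarrow> nat) \<Rightarrow> nat \<Rightarrow> nat) \<Rightarrow> bool" where
  "address_iso \<xi> \<eta> \<Phi> \<Psi> \<longleftrightarrow>
     (\<forall>x\<in>cofinality_class \<xi>. \<Phi> x \<in> cofinality_class \<eta> \<and> \<Psi> (\<Phi> x) = x) \<and>
     (\<forall>y\<in>cofinality_class \<eta>. \<Psi> y \<in> cofinality_class \<xi> \<and> \<Phi> (\<Psi> y) = y) \<and>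
     (\<forall>x\<in>cofinality_class \<xi>. \<forall>y. hadj x y \<longrightarrow> hadj (\<Phi> x) (\<Phi> y)) \<and>
     (\<forall>x\<in>cofinality_class \<eta>. \<forall>y. hadj x y \<longrightarrow> hadj (\<Psi> x) (\<Psi> y))"

lemma address_iso_sym: "address_iso \<xi> \<eta> \<Phi> \<Psi> \<Longrightarrow> address_iso \<eta> \<xi> \<Psi> \<Phi>"
  by (auto simp: address_iso_def)

lemma ring_in_class:
  "x \<in> cofinality_class \<xi> \<Longrightarrow> e \<in> ring (tail x) \<Longrightarrow> e \<subseteq> cofinality_class \<xi>"
  using class_cons class_tail by (auto simp: ring_def ring_edge_def)

text \<open>A cell is an even set of \<open>r\<close> edges; so is its image, which must then be a cell.\<close>

lemma address_iso_cell_adj: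
  assumes iso: "address_iso \<xi> \<eta> \<Phi> \<Psi>" and x: "x \<in> cofinality_class \<xi>" and a: "cell_adj x y"
  shows "cell_adj (\<Phi> x) (\<Phi> y)"
proof -
  let ?E = "(`) \<Phi> ` ring (tail x)"
  have t: "tail x \<in> seqs" using x class_seqs by simp
  have inj: "inj_on \<Phi> (cofinality_class \<xi>)" using iso by (metis address_iso_def inj_on_inverseI)
  note sub = ring_in_class[OF x]
  have "even_set ?E" using even_set_image[OF inj sub even_ring[OF t]] .
  moreover have c: "card ?E = r" using card_image_edges[OF inj sub] card_ring by simp
  moreover have "?E \<subseteq> cell_edges \<union> link_edges"
  proof
    fix f assume "f \<in> ?E"
    then obtain e where e: "e \<in> ring (tail x)" "f = \<Phi> ` e" by auto
    then have "e \<in> cell_edges \<union> link_edges" using ring_subset_cell_edges[OF t] by blast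
    then obtain a b where ab: "e = {a, b}" "hadj a b" by (elim hadj_edgeE)
    then have "hadj (\<Phi> a) (\<Phi> b)" using iso sub[OF e(1)] by (auto simp: address_iso_def)
    then have "{\<Phi> a, \<Phi> b} \<in> cell_edges \<union> link_edges" using hadj_edge_iff by blast
    then show "f \<in> cell_edges \<union> link_edges" using ab e by simp
  qed
  moreover have "?E \<noteq> {}" using c r_ge_3 by auto
  ultimately obtain u where u: "u \<in> seqs" "?E = ring u" using even_set_girth by metis
  have "{x, y} \<in> ring (tail x)" using cell_adj_in_ring[OF a] .
  then have "\<Phi> ` {x, y} \<in> ?E" by (rule imageI)
  then have "{\<Phi> x, \<Phi> y} \<in> ring u" using u by simp
  then have "{\<Phi> x, \<Phi> y} \<in> cell_edges" using u ring_subset_cell_edges by blast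
  then show ?thesis using cell_adj_sym by (auto simp: cell_edges_def doubleton_eq_iff)
qed

lemma address_iso_link:
  assumes iso: "address_iso \<xi> \<eta> \<Phi> \<Psi>" and x: "x \<in> cofinality_class \<xi>" and a: "link x y"
  shows "link (\<Phi> x) (\<Phi> y)"
proof (rule ccontr)
  have y: "y \<in> cofinality_class \<xi>" using class_hadj[OF x] a by (simp add: hadj_def)
  assume "\<not> link (\<Phi> x) (\<Phi> y)"
  moreover have "hadj (\<Phi> x) (\<Phi> y)" using iso x a by (auto simp: address_iso_def hadj_def)
  ultimately have "cell_adj (\<Phi> x) (\<Phi> y)" unfolding hadj_def by blast
  moreover have "\<Phi> x \<in> cofinality_class \<eta>" using iso x by (simp add: address_iso_def)
  ultimately have "cell_adj (\<Psi> (\<Phi> x)) (\<Psi> (\<Phi> y))"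
    using address_iso_cell_adj[OF address_iso_sym[OF iso]] by blast
  then have "cell_adj x y" using iso x y by (simp add: address_iso_def)
  then show False using a link_not_cell_adj by blast
qed

text \<open>The first letter \<open>0\<close> is arbitrary: as cells go to cells, the tail of the image depends only on the
tail.\<close>

definition induced :: "((nat \<Rightarrow> nat) \<Rightarrow> nat \<Rightarrow> nat) \<Rightarrow> (nat \<Rightarrow> nat) \<Rightarrow> nat \<Rightarrow> nat" where
  "induced \<Phi> u = tail (\<Phi> (cons 0 u))"

lemma tail_address_iso:
  assumes iso: "address_iso \<xi> \<eta> \<Phi> \<Psi>" and x: "x \<in> cofinality_class \<xi>"
  shows "tail (\<Phi> x) = induced \<Phi> (tail x)"
proof -
  let ?u = "tail x"
  have u: "?u \<in> cofinality_class (tail \<xi>)" using class_tail x by simp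
  have r0: "0 < r" "x 0 < r" using r_ge_3 x class_seqs seqsD by auto
  have "tail (\<Phi> (cons (x 0) ?u)) = tail (\<Phi> (cons 0 ?u))"
    using r0(1) refl _ r0(2)
  proof (rule nx_induct)
    fix k assume k: "k < r" "tail (\<Phi> (cons k ?u)) = tail (\<Phi> (cons 0 ?u))"
    have "cell_adj (\<Phi> (cons k ?u)) (\<Phi> (cons (nx k) ?u))"
      using address_iso_cell_adj[OF iso class_cons[OF k(1) u]] class_seqs[OF u] k(1)
      by (simp add: cell_adj_cons ring_adj_nx)
    then show "tail (\<Phi> (cons (nx k) ?u)) = tail (\<Phi> (cons 0 ?u))" using k by (simp add: cell_adj_def)
  qed
  then show ?thesis by (simp add: induced_def)
qed

lemma address_iso_induced:
  assumes iso: "address_iso \<xi> \<eta> \<Phi> \<Psi>"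
  shows "address_iso (tail \<xi>) (tail \<eta>) (induced \<Phi>) (induced \<Psi>)"
proof -
  have r0: "0 < r" using r_ge_3 by simp
  have half: "induced \<Phi> u \<in> cofinality_class (tail \<eta>) \<and> induced \<Psi> (induced \<Phi> u) = u \<and>
      (\<forall>v. hadj u v \<longrightarrow> hadj (induced \<Phi> u) (induced \<Phi> v))"
    if iso: "address_iso \<xi> \<eta> \<Phi> \<Psi>" and u: "u \<in> cofinality_class (tail \<xi>)" for \<xi> \<eta> \<Phi> \<Psi> u
  proof (intro conjI allI impI)
    let ?x = "cons 0 u"
    have x: "?x \<in> cofinality_class \<xi>" using class_cons[OF r0 u] .
    then have fx: "\<Phi> ?x \<in> cofinality_class \<eta>" and inv: "\<Psi> (\<Phi> ?x) = ?x" using iso by (auto simp: address_iso_def)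
    show "induced \<Phi> u \<in> cofinality_class (tail \<eta>)" using class_tail[OF fx] by (simp add: induced_def)
    show "induced \<Psi> (induced \<Phi> u) = u"
      using tail_address_iso[OF address_iso_sym[OF iso] fx] inv by (simp add: induced_def)
    fix v assume "hadj u v"
    then obtain i j where l: "link (cons i u) (cons j v)" using hadj_lift by blast
    then have i: "cons i u \<in> cofinality_class \<xi>" using class_cons u by (auto simp: link_def)
    then have j: "cons j v \<in> cofinality_class \<xi>" using class_hadj l by (auto simp: hadj_def)
    have "link (\<Phi> (cons i u)) (\<Phi> (cons j v))" using address_iso_link[OF iso i l] .
    then show "hadj (induced \<Phi> u) (induced \<Phi> v)"
      using link_tail tail_address_iso[OF iso i] tail_address_iso[OF iso j] by fastforce
  qed
  show ?thesis unfolding address_iso_def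
    using half[OF iso] half[OF address_iso_sym[OF iso]] by blast
qed

text \<open>What an isomorphism does to the first letter of the words with tail \<open>u\<close>. It is the identity on the
numbers that are not letters, as elements of the dihedral group are.\<close>

definition letter_map :: "((nat \<Rightarrow> nat) \<Rightarrow> nat \<Rightarrow> nat) \<Rightarrow> (nat \<Rightarrow> nat) \<Rightarrow> nat \<Rightarrow> nat" where
  "letter_map \<Phi> u i = (if i < r then \<Phi> (cons i u) 0 else i)"

lemma address_iso_cons:
  assumes iso: "address_iso \<xi> \<eta> \<Phi> \<Psi>" and u: "u \<in> cofinality_class (tail \<xi>)" and i: "i < r"
  shows "\<Phi> (cons i u) = cons (letter_map \<Phi> u i) (induced \<Phi> u)"
  by (rule seq_eqI) (use tail_address_iso[OF iso class_cons[OF i u]] i in \<open>auto simp: letter_map_def\<close>)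

lemma letter_map_dihedral:
  assumes iso: "address_iso \<xi> \<eta> \<Phi> \<Psi>" and u: "u \<in> cofinality_class (tail \<xi>)"
  shows "letter_map \<Phi> u permutes {..<r}" "rotation (letter_map \<Phi> u) \<or> reflection (letter_map \<Phi> u)"
proof -
  let ?\<sigma> = "letter_map \<Phi> u"
  have less: "?\<sigma> i < r" if "i < r" for i
    using iso class_cons[OF that u] class_seqs seqsD that by (auto simp: letter_map_def address_iso_def)
  have inj: "inj_on ?\<sigma> {..<r}"
  proof (rule inj_onI)
    fix i j assume ij: "i \<in> {..<r}" "j \<in> {..<r}" "?\<sigma> i = ?\<sigma> j"
    then have "\<Phi> (cons i u) = \<Phi> (cons j u)" using address_iso_cons[OF iso u] by auto
    then have "cons i u = cons j u" using iso ij class_cons u by (metis address_iso_def lessThan_iff)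
    then show "i = j" by simp
  qed
  show "rotation ?\<sigma> \<or> reflection ?\<sigma>"
  proof (rule rotation_or_reflection[OF less inj])
    fix i j assume a: "ring_adj i j"
    then have "cell_adj (cons i u) (cons j u)" using u class_seqs by (auto simp: cell_adj_cons)
    then have "cell_adj (\<Phi> (cons i u)) (\<Phi> (cons j u))"
      using address_iso_cell_adj[OF iso] class_cons u a by (auto simp: ring_adj_def)
    then show "ring_adj (?\<sigma> i) (?\<sigma> j)" using a by (simp add: cell_adj_def letter_map_def ring_adj_def)
  qed
  have "bij_betw ?\<sigma> {..<r} {..<r}"
    using inj less by (intro bij_betw_imageI endo_inj_surj) auto
  then show "?\<sigma> permutes {..<r}" by (rule bij_imp_permutes) (simp add: letter_map_def)
qed

lemma link_at_corners:
  assumes "v \<in> seqs" "i < r"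
  shows "link (cons (up i) (cons i v)) (cons (dn (nx i)) (cons (nx i) v))"
  unfolding link_def using assms glue_at_cons[of "cons i v" "cons (nx i) v" i] by auto

lemma ring_adj_image:
  assumes "rotation \<sigma> \<or> reflection \<sigma>" "ring_adj i j"
  shows "ring_adj (\<sigma> i) (\<sigma> j)"
proof -
  have "ring_adj (\<sigma> k) (\<sigma> (nx k))" if "k < r" for k
    using assms(1) that letter_less(1)[of k] unfolding ring_adj_def rotation_def reflection_def by metis
  then show ?thesis using assms(2) ring_adj_sym by (auto simp: ring_adj_def)
qed

text \<open>Write \<open>u = i v\<close>, and let \<open>\<sigma>\<close> be the permutation on this cell and \<open>\<tau>\<close> the one on the cell of
\<open>v\<close>, one level up. The corner \<open>up i\<close> of the cell \<open>i v\<close> is linked to the cell \<open>nx i v\<close>, and this link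
goes to a link between the images of the two cells. Which corner of the image cell carries it is
dictated by whether \<open>\<tau>\<close> preserves or reverses the direction of the
ring, and in either case it is the corner \<open>\<tau> (up i)\<close>. The same holds for \<open>dn i\<close>, so \<open>\<sigma>\<close> and
\<open>\<tau>\<close> agree at both corners.\<close>

lemma letter_map_step:
  assumes iso: "address_iso \<xi> \<eta> \<Phi> \<Psi>" and u: "u \<in> cofinality_class (tail \<xi>)"
  shows "letter_map \<Phi> u = letter_map (induced \<Phi>) (tail u)"
proof -
  let ?\<sigma> = "letter_map \<Phi> u" and ?v = "tail u" and ?i = "u 0"
  let ?\<tau> = "letter_map (induced \<Phi>) ?v"
  have i: "?i < r" using u class_seqs seqsD by blast
  have v: "?v \<in> cofinality_class (tail (tail \<xi>))" using class_tail u by blast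
  note iso' = address_iso_induced[OF iso]
  have ind: "induced \<Phi> (cons j ?v) = cons (?\<tau> j) (induced (induced \<Phi>) ?v)" if "j < r" for j
    using address_iso_cons[OF iso' v that] .
  have vs: "?v \<in> seqs" using v class_seqs by blast
  have image: "\<exists>b'. link (cons (?\<sigma> a) (cons (?\<tau> ?i) (induced (induced \<Phi>) ?v))) (cons b' (cons (?\<tau> j) (induced (induced \<Phi>) ?v)))"
    if "link (cons a u) (cons b (cons j ?v))" for a b j
  proof -
    have less: "a < r" "j < r" "b < r" using that by (auto simp: link_def)
    have "cons j ?v \<in> cofinality_class (tail \<xi>)" using class_cons[OF less(2) v] by simp
    then have "\<Phi> (cons b (cons j ?v)) = cons (letter_map \<Phi> (cons j ?v) b) (induced \<Phi> (cons j ?v))"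
      using address_iso_cons[OF iso] less by blast
    moreover have "\<Phi> (cons a u) = cons (?\<sigma> a) (induced \<Phi> u)"
      using address_iso_cons[OF iso u less(1)] .
    moreover have "induced \<Phi> u = cons (?\<tau> ?i) (induced (induced \<Phi>) ?v)" using ind[OF i] by simp
    ultimately show ?thesis
      using address_iso_link[OF iso _ that] class_cons[OF less(1) u] ind[OF less(2)] by metis
  qed
  have t2: "?\<tau> permutes {..<r}" "rotation ?\<tau> \<or> reflection ?\<tau>" 
    using letter_map_dihedral[OF iso' v] by auto
  have s2: "?\<sigma> permutes {..<r}" "rotation ?\<sigma> \<or> reflection ?\<sigma>" 
    using letter_map_dihedral[OF iso u] by auto
  obtain j where j: "j < r" "nx j = ?i" using nx_surj i by blast
  have "link (cons (up ?i) u) (cons (dn (nx ?i)) (cons (nx ?i) ?v))"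
    using link_at_corners[OF vs i] by simp
  then obtain b where b: "link (cons (?\<sigma> (up ?i)) (cons (?\<tau> ?i) (induced (induced \<Phi>) ?v))) (cons b (cons (?\<tau> (nx ?i)) (induced (induced \<Phi>) ?v)))"
    using image by blast
  have "link (cons (dn ?i) u) (cons (up j) (cons j ?v))"
    using link_sym[OF link_at_corners[OF vs j(1)]] j by simp
  then obtain c where c: "link (cons (?\<sigma> (dn ?i)) (cons (?\<tau> ?i) (induced (induced \<Phi>) ?v))) (cons c (cons (?\<tau> j) (induced (induced \<Phi>) ?v)))"
    using image by blast
  have cs: "cons d (cons k w) 1 = k" for d k w by (metis One_nat_def cons_simps)
  have w: "induced (induced \<Phi>) ?v \<in> seqs" and less\<tau>: "?\<tau> k < r" if "k < r" for k
    using b permutes_in_image[OF t2(1), of k] that by (auto simp: link_def)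
  have adj: "ring_adj (?\<tau> ?i) (?\<tau> (nx ?i))" "ring_adj (?\<tau> ?i) (?\<tau> j)"
    using ring_adj_image[OF t2(2)] ring_adj_nx[OF i] ring_adj_sym[OF ring_adj_nx[OF j(1)]] j(2) by auto
  have B: "?\<sigma> (up ?i) = up (?\<tau> ?i) \<and> ?\<tau> (nx ?i) = nx (?\<tau> ?i) \<or> ?\<sigma> (up ?i) = dn (?\<tau> ?i) \<and> ?\<tau> ?i = nx (?\<tau> (nx ?i))"
    using link_over_cell[OF b] adj(1) w[OF i] by (simp add: cell_adj_cons cs)
  have C: "?\<sigma> (dn ?i) = up (?\<tau> ?i) \<and> ?\<tau> j = nx (?\<tau> ?i) \<or> ?\<sigma> (dn ?i) = dn (?\<tau> ?i) \<and> ?\<tau> ?i = nx (?\<tau> j)"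
    using link_over_cell[OF c] adj(2) w[OF i] by (simp add: cell_adj_cons cs)
  have nn: "nx (nx k) \<noteq> k" if "k < r" for k using letter_neq(5) that by blast
  have agree: "?\<sigma> (up ?i) = ?\<tau> (up ?i)" "?\<sigma> (dn ?i) = ?\<tau> (dn ?i)"
  proof -
    have "?\<sigma> (up ?i) = ?\<tau> (up ?i) \<and> ?\<sigma> (dn ?i) = ?\<tau> (dn ?i)"
    proof (cases "rotation ?\<tau>")
      case True
      then have e: "?\<tau> (nx ?i) = nx (?\<tau> ?i)" "?\<tau> ?i = nx (?\<tau> j)"
        using True[unfolded rotation_def, rule_format, OF i] True[unfolded rotation_def, rule_format, OF j(1)] j(2) by auto
      have "?\<tau> ?i \<noteq> nx (?\<tau> (nx ?i))" using e(1) nn[OF less\<tau>[OF i]] by metis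
      moreover have "?\<tau> j \<noteq> nx (?\<tau> ?i)" using e(2) nn[OF less\<tau>[OF j(1)]] by metis
      ultimately show ?thesis using B C rotation_corners[OF True i] by metis
    next
      case False
      then have R: "reflection ?\<tau>" using t2 by blast
      then have e: "?\<tau> ?i = nx (?\<tau> (nx ?i))" "?\<tau> j = nx (?\<tau> ?i)"
        using R[unfolded reflection_def, rule_format, OF i] R[unfolded reflection_def, rule_format, OF j(1)] j(2) by auto
      have "?\<tau> (nx ?i) \<noteq> nx (?\<tau> ?i)" using e(1) nn[OF less\<tau>[OF letter_less(1)]] by metis
      moreover have "?\<tau> ?i \<noteq> nx (?\<tau> j)" using e(2) nn[OF less\<tau>[OF i]] by metis
      ultimately show ?thesis using B C reflection_corners[OF R i] by metis
    qed
    then show "?\<sigma> (up ?i) = ?\<tau> (up ?i)" "?\<sigma> (dn ?i) = ?\<tau> (dn ?i)" by auto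
  qed
  have "?\<sigma> k = ?\<tau> k" if k: "k < r" for k
    using s2(2) t2(2) agree rotation_eqI[OF _ _ letter_less(2) _ k] reflection_eqI[OF _ _ letter_less(2) _ k]
      rotation_reflection_disagree[OF _ _ i] by metis
  moreover have "?\<sigma> k = ?\<tau> k" if "\<not> k < r" for k
    using that by (simp add: letter_map_def)
  ultimately show ?thesis by blast
qed

text \<open>The \<open>n\<close>-th letter is the first letter of the \<open>n\<close>-th tail, on which the \<open>n\<close> times induced
isomorphism acts; its letter permutation is the one of level zero.\<close>

lemma address_iso_letterwise:
  assumes "address_iso \<xi> \<eta> \<Phi> \<Psi>" "x \<in> cofinality_class \<xi>"
  shows "\<Phi> x n = letter_map \<Phi> (tail x) (x n)"
  using assms
proof (induction n arbitrary: \<xi> \<eta> \<Phi> \<Psi> x)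
  case 0
  have "x 0 < r" using class_seqs[OF 0(2)] seqsD by blast
  then show ?case by (simp only: letter_map_def cons_head_tail if_True)
next
  case (Suc n)
  have "\<Phi> x (Suc n) = induced \<Phi> (tail x) n" using tail_address_iso[OF Suc.prems] by (metis tail_apply)
  also have "\<dots> = letter_map (induced \<Phi>) (tail (tail x)) (tail x n)"
    using Suc.IH[OF address_iso_induced[OF Suc.prems(1)] class_tail[OF Suc.prems(2)]] .
  also have "\<dots> = letter_map \<Phi> (tail x) (x (Suc n))"
    using letter_map_step[OF Suc.prems(1) class_tail[OF Suc.prems(2)]] by simp
  finally show ?case .
qed

theorem address_iso_imp_dihedral:
  assumes "address_iso \<xi> \<eta> \<Phi> \<Psi>" "\<xi> \<in> seqs"
  shows "\<exists>\<sigma>\<in>dihedral r. cofinal_seqs \<eta> (\<sigma> \<circ> \<xi>)"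
proof
  have x: "\<xi> \<in> cofinality_class \<xi>" using assms cofinal_refl by (simp add: cofinality_class_def)
  let ?\<sigma> = "letter_map \<Phi> (tail \<xi>)"
  show "?\<sigma> \<in> dihedral r" using letter_map_dihedral[OF assms(1) class_tail[OF x]] by (simp add: dihedral_iff)
  have "\<Phi> \<xi> = ?\<sigma> \<circ> \<xi>" using address_iso_letterwise[OF assms(1) x] by auto
  then show "cofinal_seqs \<eta> (?\<sigma> \<circ> \<xi>)"
    using assms(1) x cofinal_sym by (auto simp: address_iso_def cofinality_class_def)
qed

end

section \<open>Recognising the cells of the gasket\<close>

context polygon_gasket
begin

text \<open>A vertex of the gasket is represented by the set of its addresses, of which there are one or two.\<close>

definition point :: "(nat \<Rightarrow> nat) \<Rightarrow> (nat \<Rightarrow> nat) set" where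
  "point x = {y. y = x \<or> link x y}"

lemma point_link: "link x z \<Longrightarrow> point x = {x, z}"
  unfolding point_def using link_unique by blast

lemma point_eq_iff: "point x = point y \<longleftrightarrow> x = y \<or> link x y"
proof
  assume "point x = point y"
  then have "y \<in> point x" by (simp add: point_def)
  then show "x = y \<or> link x y" by (auto simp: point_def)
next
  assume "x = y \<or> link x y"
  then show "point x = point y"
  proof
    assume l: "link x y"
    then show ?thesis using point_link[OF l] point_link[OF link_sym[OF l]] by (simp add: insert_commute)
  qed simp
qed

lemma point_inj_cell: "tail x = tail y \<Longrightarrow> point x = point y \<Longrightarrow> x = y"
  using link_tail_neq by (auto simp: point_eq_iff)

text \<open>Two cells share at most one vertex, since the tails determine a link. Hence identifying linked
addresses produces no double edges, and edges of the gasket are the same thing as cell edges.\<close>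

lemma inj_on_point_cell_edges: "inj_on ((`) point) cell_edges"
proof (rule inj_onI)
  have *: "x = x' \<and> y = y'" 
    if a: "cell_adj x y" "cell_adj x' y'" and p: "point x = point x'" "point y = point y'" for x y x' y'
  proof -
    have t: "tail x = tail y" "tail x' = tail y'" using a by (auto simp: cell_adj_def)
    show ?thesis
    proof (cases "link x x'")
      case False
      then have "x = x'" using p by (simp add: point_eq_iff)
      then show ?thesis using p t point_inj_cell by metis
    next
      case True
      then have "y \<noteq> y'" using t link_tail_neq by metis
      then have "link y y'" using p by (simp add: point_eq_iff)
      then have "x = y" using True t link_determined_by_tails by blast
      then show ?thesis using a cell_adj_neq by blast
    qed
  qed
  fix e f assume "e \<in> cell_edges" "f \<in> cell_edges" and eq: "point ` e = point ` f"
  then obtain x y x' y' where e: "e = {x, y}" "cell_adj x y" and f: "f = {x', y'}" "cell_adj x' y'"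
    by (auto simp: cell_edges_def)
  from eq have "point x = point x' \<and> point y = point y' \<or> point x = point y' \<and> point y = point x'"
    by (auto simp: e f doubleton_eq_iff)
  then show "e = f"
    using *[OF e(2) f(2)] *[OF e(2) cell_adj_sym[OF f(2)]] e(1) f(1) by blast
qed

text \<open>The degree of a vertex of the gasket is the sum of the degrees of its addresses, because no cell edge
contains two addresses of one vertex.\<close>

lemma point_degree:
  assumes X: "X \<subseteq> cell_edges" "finite X" and even: "even_set ((`) point ` X)"
  shows "link x z \<Longrightarrow> even (card {e \<in> X. x \<in> e} + card {e \<in> X. z \<in> e})"
    and "(\<And>z. \<not> link x z) \<Longrightarrow> even (card {e \<in> X. x \<in> e})"
proof -
  let ?N = "{e \<in> X. \<exists>y\<in>e. point y = point x}"
  have "{a \<in> (`) point ` X. point x \<in> a} = (`) point ` ?N" by auto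
  moreover have "inj_on ((`) point) ?N" by (rule inj_on_subset[OF inj_on_point_cell_edges]) (use X in auto)
  ultimately have "card {a \<in> (`) point ` X. point x \<in> a} = card ?N" using card_image by simp
  moreover have "even (card {a \<in> (`) point ` X. point x \<in> a})" using even unfolding even_set_def by blast
  ultimately have N: "even (card ?N)" by argo
  show "even (card {e \<in> X. x \<in> e} + card {e \<in> X. z \<in> e})" if l: "link x z"
  proof -
    have "point y = point x \<longleftrightarrow> y = x \<or> y = z" for y
      using l link_unique link_sym unfolding point_eq_iff by blast
    then have "?N = {e \<in> X. x \<in> e} \<union> {e \<in> X. z \<in> e}" by auto
    moreover have "{e \<in> X. x \<in> e} \<inter> {e \<in> X. z \<in> e} = {}"
    proof -
      have "tail a = tail b" if "e \<in> X" "a \<in> e" "b \<in> e" for e a b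
        using subsetD[OF X(1) that(1)] that(2,3) by (auto simp: cell_edges_def cell_adj_def)
      then show ?thesis using link_tail_neq[OF l] by blast
    qed
    ultimately show ?thesis using N X(2) by (simp add: card_Un_disjoint)
  qed
  show "even (card {e \<in> X. x \<in> e})" if "\<And>z. \<not> link x z"
  proof -
    have "?N = {e \<in> X. x \<in> e}" using that link_sym by (auto simp: point_eq_iff)
    then show ?thesis using N by simp
  qed
qed

lemma cell_edges_disjoint_link_edges: "cell_edges \<inter> link_edges = {}"
proof -
  have False if "cell_adj x y" "link a b" "{x, y} = {a, b}" for x y a b
    using that link_not_cell_adj cell_adj_sym by (metis doubleton_eq_iff)
  then show ?thesis by (auto simp: cell_edges_def link_edges_def)
qed

text \<open>Let \<open>X\<close> be the cell edges representing an even set of \<open>r\<close> edges of the gasket. Adding the links at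
the addresses of odd degree turns it into an even set of the address graph; \<open>L\<close> denotes these links.
If there are none, \<open>X\<close> is a cell by the girth theorem. Otherwise \<open>L\<close> contracts to a nonempty even
set, so it has at least \<open>r\<close> elements. Its \<open>2 r\<close> or more end points have positive degree in \<open>X\<close>,
while the degrees in \<open>X\<close> add up to \<open>2 r\<close>. So every vertex of \<open>X\<close> is an end of a link in \<open>L\<close>, and
\<open>L\<close> contracts to exactly one cell, which means that these links join neighbouring cells of a ring
and are attached at corners. But a vertex \<open>i\<close> of the \<open>i\<close>-th cell of a ring is not a corner.\<close>

lemma short_even_set_at_tip:
  assumes X: "X \<subseteq> cell_edges" "card X = r" and even: "even_set ((`) point ` X)"
    and e: "e \<in> X" "x \<in> e" and tip: "x 0 = x 1"
  shows "X = ring (tail x)"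
proof -
  have fin: "finite X" using X r_ge_3 by (metis card.infinite not_numeral_le_zero)
  define D where "D = (\<lambda>x. card {e \<in> X. x \<in> e})"
  define Odd where "Odd = {x. odd (D x)}"
  define L where "L = point ` Odd"
  have fe: "finite e \<and> card e = 2" if "e \<in> X" for e
  proof -
    obtain y z where "e = {y, z}" "cell_adj y z" using \<open>e \<in> X\<close> X(1) by (auto simp: cell_edges_def)
    then show ?thesis using cell_adj_neq by auto
  qed
  have finUX: "finite (\<Union>X)" using fin fe by auto
  have D_pos: "0 < D y" if "y \<in> f" "f \<in> X" for y f
    using that fin by (auto simp: D_def card_gt_0_iff)
  have sub: "Odd \<subseteq> \<Union>X"
  proof
    fix y assume "y \<in> Odd"
    then have "card {e \<in> X. y \<in> e} \<noteq> 0" by (auto simp: Odd_def D_def intro: odd_pos)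
    then have "{e \<in> X. y \<in> e} \<noteq> {}" by force
    then show "y \<in> \<Union>X" by auto
  qed
  then have finO: "finite Odd" using finUX finite_subset by blast
  have partner: "\<exists>z\<in>Odd. link y z" if "y \<in> Odd" for y
  proof -
    have "odd (card {e \<in> X. y \<in> e})" using that by (simp add: Odd_def D_def)
    then obtain z where z: "link y z" using point_degree(2)[OF X(1) fin even, of y] by blast
    then show ?thesis using point_degree(1)[OF X(1) fin even z] that by (auto simp: Odd_def D_def)
  qed
  have L_link: "L \<subseteq> link_edges" 
    using partner point_link by (fastforce simp: L_def link_edges_def)
  \<comment> \<open>The vertices of degree one in \<open>L\<close> are those of odd degree in \<open>X\<close>.\<close>
  have L_at: "{e \<in> L. y \<in> e} = (if y \<in> Odd then {point y} else {})" for y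
  proof -
    have "y \<in> Odd \<and> f = point y" if "f \<in> L" "y \<in> f" for f
    proof -
      obtain w where w: "w \<in> Odd" "f = point w" using \<open>f \<in> L\<close> by (auto simp: L_def)
      then have "y = w \<or> link w y" using that by (auto simp: point_def)
      then show ?thesis using partner[OF w(1)] w link_unique point_eq_iff by metis
    qed
    then show ?thesis by (auto simp: L_def point_def)
  qed
  have disj: "X \<inter> L = {}" using X(1) L_link cell_edges_disjoint_link_edges by blast
  have even_XL: "even_set (X \<union> L)"
    unfolding even_set_def
  proof (intro conjI allI)
    show finXL: "finite (X \<union> L)" using fin finO by (simp add: L_def)
    fix y
    have "{e \<in> X \<union> L. y \<in> e} = {e \<in> X. y \<in> e} \<union> {e \<in> L. y \<in> e}" by auto
    then have "card {e \<in> X \<union> L. y \<in> e} = D y + card {e \<in> L. y \<in> e}"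
      unfolding D_def using disj finXL by (simp add: card_Un_disjoint disjoint_iff)
    then show "even (card {e \<in> X \<union> L. y \<in> e})" by (simp add: L_at Odd_def)
  qed
  show ?thesis
  proof (cases "L = {}")
    case True
    then have "even_set X" using even_XL by simp
    then obtain u where u: "X = ring u" using even_set_girth[of X] X e by auto
    then have "tail x = u" using e by (auto simp: ring_def ring_edge_def)
    then show ?thesis using u by simp
  next
    case False
    let ?P = "(`) tail ` L"
    have "(X \<union> L) \<inter> link_edges = L"
      using X(1) L_link cell_edges_disjoint_link_edges by blast
    then have "even_set ?P" using even_contract[of "X \<union> L"] even_XL X(1) L_link by auto
    moreover have "?P \<subseteq> cell_edges \<union> link_edges" using contract_link_edges L_link by blast
    moreover have "card ?P = card L"
      by (rule card_image, rule inj_on_subset[OF inj_on_contract_link_edges L_link])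
    ultimately have girth: "r \<le> card L" "card L = r \<Longrightarrow> \<exists>u\<in>seqs. ?P = ring u"
      using even_set_girth[of ?P] False by auto
    \<comment> \<open>Double counting: \<open>2 * card L = card Odd\<close>, which is at most the degree sum \<open>2 * r\<close>.\<close>
    have "(\<Sum>y\<in>Odd. card {e \<in> L. y \<in> e}) = (\<Sum>e\<in>L. card (e \<inter> Odd))"
      using finO by (intro handshake) (simp_all add: L_def)
    also have "(\<Sum>y\<in>Odd. card {e \<in> L. y \<in> e}) = card Odd" by (simp add: L_at)
    also have "(\<Sum>e\<in>L. card (e \<inter> Odd)) = (\<Sum>e\<in>L. 2)"
    proof (rule sum.cong)
      fix f assume "f \<in> L"
      then obtain y where "y \<in> Odd" "f = point y" by (auto simp: L_def)
      moreover from this obtain z where "z \<in> Odd" "link y z" using partner by blast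
      ultimately have "y \<in> Odd" "z \<in> Odd" "link y z" "f = {y, z}" using point_link by auto
      moreover from this have "y \<noteq> z" using link_neq by blast
      ultimately show "card (f \<inter> Odd) = 2" by simp
    qed simp
    finally have cO: "card Odd = 2 * card L" by simp
    have "(\<Sum>y\<in>\<Union>X. D y) = (\<Sum>f\<in>X. card (f \<inter> \<Union>X))"
      unfolding D_def by (rule handshake[OF fin finUX])
    also have "\<dots> = (\<Sum>f\<in>X. 2)"
    proof (rule sum.cong)
      fix f assume "f \<in> X"
      then have "f \<inter> \<Union>X = f" by auto
      then show "card (f \<inter> \<Union>X) = 2" using fe \<open>f \<in> X\<close> by simp
    qed simp
    finally have total: "(\<Sum>y\<in>\<Union>X. D y) = 2 * r" using X(2) by simp
    have split: "(\<Sum>y\<in>\<Union>X. D y) = (\<Sum>y\<in>\<Union>X - Odd. D y) + (\<Sum>y\<in>Odd. D y)"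
      using sum.subset_diff[OF sub finUX] .
    have "(\<Sum>y\<in>Odd. 1) \<le> (\<Sum>y\<in>Odd. D y)"
      by (rule sum_mono) (auto simp: Odd_def intro: odd_pos[THEN Suc_leI, simplified])
    then have O_le: "card Odd \<le> (\<Sum>y\<in>Odd. D y)" by simp
    have "x \<in> Odd"
    proof (rule ccontr)
      assume "x \<notin> Odd"
      then have "D x \<le> (\<Sum>y\<in>\<Union>X - Odd. D y)"
        using e finUX by (intro member_le_sum) auto
      then show False using D_pos[OF e(2,1)] O_le total split cO girth(1) by linarith
    qed
    have "card L = r" using O_le total split cO girth(1) by linarith
    then obtain u where u: "u \<in> seqs" "?P = ring u" using girth by blast
    obtain z where z: "link x z" using partner \<open>x \<in> Odd\<close> by blast
    have "{x, z} \<in> L" using \<open>x \<in> Odd\<close> point_link[OF z] by (auto simp: L_def)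
    then have "tail ` {x, z} \<in> ?P" by (rule imageI)
    then have "{tail x, tail z} \<in> cell_edges" using u ring_subset_cell_edges by auto
    then have "cell_adj (tail x) (tail z)" using cell_adj_sym by (auto simp: cell_edges_def doubleton_eq_iff)
    from link_over_cell[OF z this] have False
      using tip z letter_neq(1,2)[of "x 1"] seqsD by (metis link_def)
    then show ?thesis ..
  qed
qed

definition gasket :: "(nat \<Rightarrow> nat) \<Rightarrow> (nat \<Rightarrow> nat) set graph" where
  "gasket \<xi> = \<lparr>verts = point ` cofinality_class \<xi>,
     edges = {(point x, point y) | x y. x \<in> cofinality_class \<xi> \<and> cell_adj x y}\<rparr>"

definition gasket_edges :: "(nat \<Rightarrow> nat) \<Rightarrow> (nat \<Rightarrow> nat) set set set" where
  "gasket_edges \<xi> = {{a, b} | a b. (a, b) \<in> edges (gasket \<xi>)}"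

definition cell :: "(nat \<Rightarrow> nat) \<Rightarrow> (nat \<Rightarrow> nat) set set set" where
  "cell u = (`) point ` ring u"

lemma gasket_edges_eq:
  "gasket_edges \<xi> = (`) point ` {e \<in> cell_edges. e \<subseteq> cofinality_class \<xi>}"
proof -
  have closed: "y \<in> cofinality_class \<xi>" if "x \<in> cofinality_class \<xi>" "cell_adj x y" for x y
    using class_hadj that by (simp add: hadj_def)
  show ?thesis
  proof (intro equalityI subsetI)
    fix e assume "e \<in> gasket_edges \<xi>"
    then obtain x y where xy: "e = {point x, point y}" "x \<in> cofinality_class \<xi>" "cell_adj x y"
      by (auto simp: gasket_edges_def gasket_def)
    then have "{x, y} \<in> {e \<in> cell_edges. e \<subseteq> cofinality_class \<xi>}" 
      using closed by (auto simp: cell_edges_def)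
    then have "point ` {x, y} \<in> (`) point ` {e \<in> cell_edges. e \<subseteq> cofinality_class \<xi>}" by (rule imageI)
    then show "e \<in> (`) point ` {e \<in> cell_edges. e \<subseteq> cofinality_class \<xi>}" using xy by simp
  next
    fix e assume "e \<in> (`) point ` {e \<in> cell_edges. e \<subseteq> cofinality_class \<xi>}"
    then obtain x y where "e = {point x, point y}" "x \<in> cofinality_class \<xi>" "cell_adj x y"
      by (auto simp: cell_edges_def)
    then show "e \<in> gasket_edges \<xi>" unfolding gasket_edges_def gasket_def by auto
  qed
qed

lemma gasket_edges_subset: "e \<in> gasket_edges \<xi> \<Longrightarrow> e \<subseteq> verts (gasket \<xi>)"
  unfolding gasket_edges_eq by (auto simp: gasket_def)

lemma cell_even: 
  assumes "u \<in> seqs" shows "even_set (cell u)" "card (cell u) = r"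
proof -
  have inj: "inj_on point {x. tail x = u}" using point_inj_cell by (auto simp: inj_on_def)
  have sub: "e \<subseteq> {x. tail x = u}" if "e \<in> ring u" for e
    using that by (auto simp: ring_def ring_edge_def)
  show "even_set (cell u)" unfolding cell_def using even_set_image[OF inj sub even_ring[OF assms]] .
  show "card (cell u) = r" unfolding cell_def using card_image_edges[OF inj sub] card_ring by simp
qed

lemma cell_subset: 
  assumes "u \<in> cofinality_class (tail \<xi>)" shows "cell u \<subseteq> gasket_edges \<xi>"
proof -
  have "e \<subseteq> cofinality_class \<xi>" if "e \<in> ring u" for e
    using that class_cons assms by (auto simp: ring_def ring_edge_def)
  then show ?thesis
    unfolding cell_def gasket_edges_eq using ring_subset_cell_edges class_seqs[OF assms] by blast
qed

lemma cell_inj: 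
  assumes "u \<in> seqs" "v \<in> seqs" "cell u = cell v" shows "u = v"
proof -
  have "ring u = ring v"
    using inj_on_image_eq_iff[OF inj_on_point_cell_edges ring_subset_cell_edges[OF assms(1)] ring_subset_cell_edges[OF assms(2)]]
      assms(3) by (simp add: cell_def)
  moreover have "ring_edge u 0 \<in> ring u" using r_ge_3 by (auto simp: ring_def)
  ultimately obtain i where "i < r" "ring_edge u 0 = ring_edge v i" by (auto simp: ring_def)
  then show ?thesis using ring_edge_inj r_ge_3 by auto
qed

lemma vertices_of_cell: "\<Union>(cell u) = point ` (\<lambda>i. cons i u) ` {..<r}"
  by (auto simp: cell_def ring_def ring_edge_def)

lemma hadj_iff_cells_meet:
  assumes "u \<in> seqs" "v \<in> seqs"
  shows "hadj u v \<longleftrightarrow> u \<noteq> v \<and> \<Union>(cell u) \<inter> \<Union>(cell v) \<noteq> {}"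
proof
  assume h: "hadj u v"
  then obtain i j where l: "link (cons i u) (cons j v)" using hadj_lift by blast
  then have "i < r" "j < r" "point (cons i u) = point (cons j v)" by (auto simp: link_def point_eq_iff)
  then have "point (cons i u) \<in> \<Union>(cell u) \<inter> \<Union>(cell v)" unfolding vertices_of_cell by auto
  then show "u \<noteq> v \<and> \<Union>(cell u) \<inter> \<Union>(cell v) \<noteq> {}" using hadj_neq[OF h] by blast
next
  assume *: "u \<noteq> v \<and> \<Union>(cell u) \<inter> \<Union>(cell v) \<noteq> {}"
  then obtain i j where "point (cons i u) = point (cons j v)" unfolding vertices_of_cell by auto
  then have "link (cons i u) (cons j v)" using * by (auto simp: point_eq_iff)
  then show "hadj u v" using link_tail by fastforce
qed

text \<open>The nonempty even sets of least size; besides the cells these are, for \<open>r = 3\<close> and \<open>r = 5\<close>, the smallest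
holes.\<close>

definition short_even :: "(nat \<Rightarrow> nat) \<Rightarrow> (nat \<Rightarrow> nat) set set set \<Rightarrow> bool" where
  "short_even \<xi> C \<longleftrightarrow> C \<subseteq> gasket_edges \<xi> \<and> even_set C \<and> card C = r"

text \<open>Every edge lies in its cell, so a short even set which owns an edge exclusively is a cell; a cell
owns the edges at its vertex \<open>i\<close> if it is the \<open>i\<close>-th cell of its ring.\<close>

lemma cell_intrinsic:
  "(\<exists>u\<in>cofinality_class (tail \<xi>). C = cell u) \<longleftrightarrow>
     short_even \<xi> C \<and> (\<exists>e\<in>C. \<forall>C'. short_even \<xi> C' \<and> e \<in> C' \<longrightarrow> C' = C)"
proof (intro iffI conjI)
  assume "\<exists>u\<in>cofinality_class (tail \<xi>). C = cell u"
  then obtain u where u: "u \<in> cofinality_class (tail \<xi>)" and C: "C = cell u" by auto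
  have us: "u \<in> seqs" using class_seqs u .
  show "short_even \<xi> C" using cell_even[OF us] cell_subset[OF u] by (simp add: short_even_def C)
  \<comment> \<open>The edge leaving the vertex whose first two letters are equal.\<close>
  let ?e = "ring_edge u (u 0)"
  have i: "u 0 < r" using us seqsD by blast
  have e: "?e \<in> cell_edges" using us i cell_edges_iff by blast
  have "point ` ?e \<in> C" using i by (auto simp: C cell_def ring_def)
  moreover have "C' = C" if C': "short_even \<xi> C'" "point ` ?e \<in> C'" for C'
  proof -
    let ?X = "{e \<in> cell_edges. point ` e \<in> C'}"
    have im: "(`) point ` ?X = C'" using C' by (auto simp: short_even_def gasket_edges_eq)
    have inj: "inj_on ((`) point) ?X" by (rule inj_on_subset[OF inj_on_point_cell_edges]) auto
    have "card ?X = r" using card_image[OF inj] im C'(1) by (simp add: short_even_def)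
    then have "?X = ring (tail (cons (u 0) u))"
      using C' im e by (intro short_even_set_at_tip[of _ ?e]) (auto simp: short_even_def ring_edge_def)
    then show ?thesis using im by (simp add: C cell_def)
  qed
  ultimately show "\<exists>e\<in>C. \<forall>C'. short_even \<xi> C' \<and> e \<in> C' \<longrightarrow> C' = C" by blast
next
  assume *: "short_even \<xi> C \<and> (\<exists>e\<in>C. \<forall>C'. short_even \<xi> C' \<and> e \<in> C' \<longrightarrow> C' = C)"
  then obtain e where e: "e \<in> C" and uniq: "\<And>C'. short_even \<xi> C' \<Longrightarrow> e \<in> C' \<Longrightarrow> C' = C" by blast
  have "e \<in> gasket_edges \<xi>" using * e by (auto simp: short_even_def)
  then obtain f where f: "f \<in> cell_edges" "f \<subseteq> cofinality_class \<xi>" "e = point ` f"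
    by (auto simp: gasket_edges_eq)
  then obtain u i where ui: "u \<in> seqs" "i < r" "f = ring_edge u i" by (auto simp: cell_edges_iff)
  have "cons i u \<in> cofinality_class \<xi>" using f ui by (auto simp: ring_edge_def)
  then have u: "u \<in> cofinality_class (tail \<xi>)" using class_tail by fastforce
  have "e \<in> cell u" using f ui by (auto simp: cell_def ring_def)
  then have "cell u = C" using uniq cell_even[OF ui(1)] cell_subset[OF u] by (auto simp: short_even_def)
  then show "\<exists>u\<in>cofinality_class (tail \<xi>). C = cell u" using u by blast
qed

definition gasket_iso ::
    "(nat \<Rightarrow> nat) \<Rightarrow> (nat \<Rightarrow> nat) \<Rightarrow> ((nat \<Rightarrow> nat) set \<Rightarrow> (nat \<Rightarrow> nat) set) \<Rightarrow> ((nat \<Rightarrow> nat) set \<Rightarrow> (nat \<Rightarrow> nat) set) \<Rightarrow> bool" where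
  "gasket_iso \<xi> \<eta> \<phi> \<psi> \<longleftrightarrow>
     (\<forall>a\<in>verts (gasket \<xi>). \<phi> a \<in> verts (gasket \<eta>) \<and> \<psi> (\<phi> a) = a) \<and>
     (\<forall>b\<in>verts (gasket \<eta>). \<psi> b \<in> verts (gasket \<xi>) \<and> \<phi> (\<psi> b) = b) \<and>
     (\<forall>(a, b)\<in>edges (gasket \<xi>). (\<phi> a, \<phi> b) \<in> edges (gasket \<eta>)) \<and>
     (\<forall>(a, b)\<in>edges (gasket \<eta>). (\<psi> a, \<psi> b) \<in> edges (gasket \<xi>))"

lemma gasket_iso_sym: "gasket_iso \<xi> \<eta> \<phi> \<psi> \<Longrightarrow> gasket_iso \<eta> \<xi> \<psi> \<phi>"
  by (simp add: gasket_iso_def)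

lemma gasket_iso_inverse_image:
  assumes "gasket_iso \<xi> \<eta> \<phi> \<psi>" "C \<subseteq> gasket_edges \<xi>"
  shows "(`) \<psi> ` (`) \<phi> ` C = C"
proof -
  have id: "\<psi> ` \<phi> ` e = e" if "e \<in> C" for e
  proof -
    have "e \<subseteq> verts (gasket \<xi>)" by (rule gasket_edges_subset) (use that assms(2) in auto)
    then have "\<psi> (\<phi> a) = a" if "a \<in> e" for a using that assms(1) by (auto simp: gasket_iso_def)
    then show ?thesis by force
  qed
  have "(`) \<psi> ` (`) \<phi> ` C = (\<lambda>e. \<psi> ` \<phi> ` e) ` C" by (rule image_image)
  also have "\<dots> = (\<lambda>e. e) ` C" by (rule image_cong) (simp_all only: id)
  finally show ?thesis by simp
qed

lemma gasket_iso_short_even: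
  assumes iso: "gasket_iso \<xi> \<eta> \<phi> \<psi>" and C: "short_even \<xi> C"
  shows "short_even \<eta> ((`) \<phi> ` C)"
proof -
  have inj: "inj_on \<phi> (verts (gasket \<xi>))"
    by (rule inj_on_inverseI[of _ \<psi>]) (use iso in \<open>simp add: gasket_iso_def\<close>)
  have sub: "e \<subseteq> verts (gasket \<xi>)" if "e \<in> C" for e
    by (rule gasket_edges_subset) (use C that in \<open>auto simp: short_even_def\<close>)
  have "(`) \<phi> ` C \<subseteq> gasket_edges \<eta>"
  proof
    fix f assume "f \<in> (`) \<phi> ` C"
    then obtain e where e: "e \<in> C" "f = \<phi> ` e" by blast
    then have "e \<in> gasket_edges \<xi>" using C by (auto simp: short_even_def)
    then obtain a b where ab: "e = {a, b}" "(a, b) \<in> edges (gasket \<xi>)" by (auto simp: gasket_edges_def)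
    then have "(\<phi> a, \<phi> b) \<in> edges (gasket \<eta>)" using iso unfolding gasket_iso_def by blast
    then show "f \<in> gasket_edges \<eta>" using e ab by (auto simp: gasket_edges_def)
  qed
  then show ?thesis
    using even_set_image[OF inj sub] card_image_edges[OF inj sub] C by (simp add: short_even_def)
qed

lemma gasket_iso_cell:
  assumes iso: "gasket_iso \<xi> \<eta> \<phi> \<psi>" and u: "u \<in> cofinality_class (tail \<xi>)"
  shows "\<exists>v\<in>cofinality_class (tail \<eta>). cell v = (`) \<phi> ` cell u"
proof -
  have "short_even \<xi> (cell u) \<and> (\<exists>e\<in>cell u. \<forall>C'. short_even \<xi> C' \<and> e \<in> C' \<longrightarrow> C' = cell u)"
    using u cell_intrinsic[of \<xi> "cell u"] by blast
  then obtain e where C: "short_even \<xi> (cell u)" and e: "e \<in> cell u"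
    and uniq: "\<And>C'. short_even \<xi> C' \<Longrightarrow> e \<in> C' \<Longrightarrow> C' = cell u" by blast
  have "e \<subseteq> verts (gasket \<xi>)" by (rule gasket_edges_subset) (use e cell_subset[OF u] in auto)
  then have "\<psi> (\<phi> a) = a" if "a \<in> e" for a using that iso by (auto simp: gasket_iso_def)
  then have inv: "\<psi> ` \<phi> ` e = e" by force
  have "C' = (`) \<phi> ` cell u" if C': "short_even \<eta> C'" "\<phi> ` e \<in> C'" for C'
  proof -
    have "\<psi> ` \<phi> ` e \<in> (`) \<psi> ` C'" using C'(2) by blast
    then have "(`) \<psi> ` C' = cell u"
      using uniq gasket_iso_short_even[OF gasket_iso_sym[OF iso] C'(1)] inv by simp
    then show ?thesis
      using gasket_iso_inverse_image[OF gasket_iso_sym[OF iso], of C'] C'(1) by (simp add: short_even_def)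
  qed
  moreover have "\<phi> ` e \<in> (`) \<phi> ` cell u" using e by (rule imageI)
  ultimately have "\<exists>f\<in>(`) \<phi> ` cell u. \<forall>C'. short_even \<eta> C' \<and> f \<in> C' \<longrightarrow> C' = (`) \<phi> ` cell u"
    by (intro bexI[of _ "\<phi> ` e"]) auto
  then obtain v where "v \<in> cofinality_class (tail \<eta>)" "(`) \<phi> ` cell u = cell v"
    using iffD2[OF cell_intrinsic conjI[OF gasket_iso_short_even[OF iso C]]] by (elim bexE) auto
  then show ?thesis by (intro bexI[of _ v]) auto
qed

text \<open>Cells are named by their tails, so permuting cells means mapping tails to tails.\<close>

definition cell_map :: "(nat \<Rightarrow> nat) \<Rightarrow> ((nat \<Rightarrow> nat) set \<Rightarrow> (nat \<Rightarrow> nat) set) \<Rightarrow> (nat \<Rightarrow> nat) \<Rightarrow> nat \<Rightarrow> nat" where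
  "cell_map \<eta> \<phi> u = (SOME v. v \<in> cofinality_class (tail \<eta>) \<and> cell v = (`) \<phi> ` cell u)"

lemma cell_map:
  assumes iso: "gasket_iso \<xi> \<eta> \<phi> \<psi>" and u: "u \<in> cofinality_class (tail \<xi>)"
  shows "cell_map \<eta> \<phi> u \<in> cofinality_class (tail \<eta>)" "cell (cell_map \<eta> \<phi> u) = (`) \<phi> ` cell u"
  using someI_ex[of "\<lambda>v. v \<in> cofinality_class (tail \<eta>) \<and> cell v = (`) \<phi> ` cell u"] gasket_iso_cell[OF assms]
  unfolding cell_map_def by blast+

theorem gasket_iso_imp_address_iso:
  assumes iso: "gasket_iso \<xi> \<eta> \<phi> \<psi>"
  shows "address_iso (tail \<xi>) (tail \<eta>) (cell_map \<eta> \<phi>) (cell_map \<xi> \<psi>)"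
proof -
  have inv: "cell_map \<xi> \<psi> (cell_map \<eta> \<phi> u) = u"
    if iso: "gasket_iso \<xi> \<eta> \<phi> \<psi>" and u: "u \<in> cofinality_class (tail \<xi>)" for \<xi> \<eta> \<phi> \<psi> u
  proof -
    note 1 = cell_map[OF iso u]
    note 2 = cell_map[OF gasket_iso_sym[OF iso] 1(1)]
    have "cell (cell_map \<xi> \<psi> (cell_map \<eta> \<phi> u)) = cell u"
      using 1 2 gasket_iso_inverse_image[OF iso cell_subset[OF u]] by simp
    then show ?thesis using cell_inj class_seqs 2(1) u by blast
  qed
  have adj: "hadj (cell_map \<eta> \<phi> u) (cell_map \<eta> \<phi> v)"
    if iso: "gasket_iso \<xi> \<eta> \<phi> \<psi>" and u: "u \<in> cofinality_class (tail \<xi>)" and h: "hadj u v" for \<xi> \<eta> \<phi> \<psi> u v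
  proof -
    have v: "v \<in> cofinality_class (tail \<xi>)" using class_hadj[OF u h] .
    have "u \<noteq> v" "\<Union>(cell u) \<inter> \<Union>(cell v) \<noteq> {}"
      using hadj_iff_cells_meet class_seqs u v h by blast+
    then obtain a e f where "a \<in> e" "e \<in> cell u" "a \<in> f" "f \<in> cell v" by blast
    then have "\<phi> a \<in> \<Union>(cell (cell_map \<eta> \<phi> u)) \<inter> \<Union>(cell (cell_map \<eta> \<phi> v))"
      using cell_map(2)[OF iso u] cell_map(2)[OF iso v] by blast
    moreover have "cell_map \<eta> \<phi> u \<noteq> cell_map \<eta> \<phi> v"
      using inv[OF iso u] inv[OF iso v] \<open>u \<noteq> v\<close> by metis
    ultimately show ?thesis
      using hadj_iff_cells_meet class_seqs cell_map(1)[OF iso u] cell_map(1)[OF iso v] by blast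
  qed
  show ?thesis
    unfolding address_iso_def
    using cell_map(1)[OF iso] cell_map(1)[OF gasket_iso_sym[OF iso]] inv[OF iso] inv[OF gasket_iso_sym[OF iso]]
      adj[OF iso] adj[OF gasket_iso_sym[OF iso]] by blast
qed


end

section \<open>The dihedral action\<close>

context polygon_gasket
begin

lemma dihedral_inv:
  assumes "\<sigma> \<in> dihedral r" shows "inv \<sigma> \<in> dihedral r"
proof -
  have p: "\<sigma> permutes {..<r}" "rotation \<sigma> \<or> reflection \<sigma>" using assms by (auto simp: dihedral_iff)
  have less: "inv \<sigma> i < r" if "i < r" for i using permutes_in_image[OF permutes_inv[OF p(1)], of i] that by simp
  have i1: "\<sigma> (inv \<sigma> i) = i" "inv \<sigma> (\<sigma> i) = i" for i using permutes_inverses[OF p(1)] by auto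
  have "rotation (inv \<sigma>)" if "rotation \<sigma>"
    unfolding rotation_def
  proof (intro allI impI conjI less)
    fix i assume "i < r"
    then have "\<sigma> (nx (inv \<sigma> i)) = nx i" using that less i1 by (simp add: rotation_def)
    then show "inv \<sigma> (nx i) = nx (inv \<sigma> i)" using i1 by metis
  qed
  moreover have "reflection (inv \<sigma>)" if "reflection \<sigma>"
    unfolding reflection_def
  proof (intro allI impI conjI less)
    fix i assume i: "i < r"
    let ?k = "inv \<sigma> (nx i)"
    have "nx (\<sigma> (nx ?k)) = nx i" "\<sigma> (nx ?k) < r" using that less i1 by (auto simp: reflection_def)
    then have "\<sigma> (nx ?k) = i" using nx_inj i by blast
    then show "nx (inv \<sigma> (nx i)) = inv \<sigma> i" using i1 by metis
  qed
  ultimately show ?thesis using permutes_inv[OF p(1)] p(2) by (auto simp: dihedral_iff)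
qed

lemma dihedral_less: "\<sigma> \<in> dihedral r \<Longrightarrow> i < r \<Longrightarrow> \<sigma> i < r"
  by (auto simp: dihedral_iff rotation_def reflection_def)

lemma dihedral_seqs: "\<sigma> \<in> dihedral r \<Longrightarrow> x \<in> seqs \<Longrightarrow> \<sigma> \<circ> x \<in> seqs"
  using dihedral_less by (simp add: seqs_def)

lemma dihedral_cell_adj: 
  assumes "\<sigma> \<in> dihedral r" "cell_adj x y" shows "cell_adj (\<sigma> \<circ> x) (\<sigma> \<circ> y)"
proof -
  have "tail (\<sigma> \<circ> z) = \<sigma> \<circ> tail z" for z by (auto simp: tail_def)
  then show ?thesis using assms dihedral_seqs ring_adj_image by (auto simp: cell_adj_def dihedral_iff)
qed

text \<open>A reflection exchanges the two corners of a cell and reverses the ring of copies, so it turns the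
gluing of copies \<open>i\<close> and \<open>nx i\<close> into a gluing read from the other side.\<close>

lemma dihedral_link:
  assumes \<sigma>: "\<sigma> \<in> dihedral r" and l: "link x y" shows "link (\<sigma> \<circ> x) (\<sigma> \<circ> y)"
proof -
  have R: "rotation \<sigma> \<or> reflection \<sigma>" using \<sigma> by (simp add: dihedral_iff)
  have "\<exists>j. glue_at m j (\<sigma> \<circ> x) (\<sigma> \<circ> y) \<or> glue_at m j (\<sigma> \<circ> y) (\<sigma> \<circ> x)" if g: "glue_at m i x y" for m i x y
    using R
  proof
    assume rot: "rotation \<sigma>"
    have i: "i < r" using g by (simp add: glue_at_def)
    have nx: "\<sigma> (nx i) = nx (\<sigma> i)" using rot i by (simp add: rotation_def)
    have "glue_at m (\<sigma> i) (\<sigma> \<circ> x) (\<sigma> \<circ> y)"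
      using g rotation_corners(1)[OF rot i] rotation_corners(2)[OF rot letter_less(1)[of i]] dihedral_less[OF \<sigma> i]
      by (simp add: glue_at_def nx)
    then show ?thesis by blast
  next
    assume ref: "reflection \<sigma>"
    have i: "i < r" using g by (simp add: glue_at_def)
    have nx: "nx (\<sigma> (nx i)) = \<sigma> i" using ref i by (simp add: reflection_def)
    have "glue_at m (\<sigma> (nx i)) (\<sigma> \<circ> y) (\<sigma> \<circ> x)"
      using g reflection_corners(1)[OF ref i] reflection_corners(2)[OF ref letter_less(1)[of i]] dihedral_less[OF \<sigma> letter_less(1)[of i]]
      by (simp add: glue_at_def nx)
    then show ?thesis by blast
  qed
  then show ?thesis using l dihedral_seqs[OF \<sigma>] unfolding link_def by metis
qed

text \<open>One inclusion holds because \<open>\<sigma>\<close> preserves links, the other because its inverse does.\<close>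

lemma dihedral_point:
  assumes \<sigma>: "\<sigma> \<in> dihedral r" shows "(\<circ>) \<sigma> ` point x = point (\<sigma> \<circ> x)"
proof -
  have inv: "inv \<sigma> \<circ> (\<sigma> \<circ> z) = z" "\<sigma> \<circ> (inv \<sigma> \<circ> z) = z" for z :: "nat \<Rightarrow> nat"
    using permutes_inverses[of \<sigma> "{..<r}"] \<sigma> by (auto simp: dihedral_iff fun_eq_iff)
  show ?thesis
  proof (intro equalityI subsetI)
    fix y assume "y \<in> (\<circ>) \<sigma> ` point x"
    then show "y \<in> point (\<sigma> \<circ> x)" using dihedral_link[OF \<sigma>] by (auto simp: point_def)
  next
    fix y assume "y \<in> point (\<sigma> \<circ> x)"
    then have "inv \<sigma> \<circ> y \<in> point x"
      using dihedral_link[OF dihedral_inv[OF \<sigma>], of "\<sigma> \<circ> x" y] inv by (auto simp: point_def)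
    then show "y \<in> (\<circ>) \<sigma> ` point x" using inv(2)[of y] by (metis imageI)
  qed
qed

theorem dihedral_imp_gasket_iso:
  assumes \<sigma>: "\<sigma> \<in> dihedral r" and cof: "cofinal_seqs \<eta> (\<sigma> \<circ> \<xi>)"
  shows "gasket_iso \<xi> \<eta> ((`) ((\<circ>) \<sigma>)) ((`) ((\<circ>) (inv \<sigma>)))"
proof -
  have inv: "inv \<sigma> \<circ> (\<sigma> \<circ> z) = z" "\<sigma> \<circ> (inv \<sigma> \<circ> z) = z" for z :: "nat \<Rightarrow> nat"
    using permutes_inverses[of \<sigma> "{..<r}"] \<sigma> by (auto simp: dihedral_iff fun_eq_iff)
  have compose: "cofinal_seqs (\<tau> \<circ> x) (\<tau> \<circ> y)" if "cofinal_seqs x y" for x y \<tau>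
    using that by (auto simp: cofinal_seqs_def) (metis)
  have cls: "\<tau> \<circ> x \<in> cofinality_class \<eta>" 
    if "\<tau> \<in> dihedral r" "cofinal_seqs \<eta> (\<tau> \<circ> \<xi>)" "x \<in> cofinality_class \<xi>" for \<tau> \<xi> \<eta> x
    using that dihedral_seqs compose cofinal_trans cofinal_sym unfolding cofinality_class_def by blast
  have verts: "(\<circ>) \<tau> ` a \<in> verts (gasket \<eta>)"
    if "\<tau> \<in> dihedral r" "cofinal_seqs \<eta> (\<tau> \<circ> \<xi>)" "a \<in> verts (gasket \<xi>)" for \<tau> \<xi> \<eta> a
    using that dihedral_point cls by (auto simp: gasket_def)
  have edges: "((\<circ>) \<tau> ` a, (\<circ>) \<tau> ` b) \<in> edges (gasket \<eta>)"
    if "\<tau> \<in> dihedral r" "cofinal_seqs \<eta> (\<tau> \<circ> \<xi>)" "(a, b) \<in> edges (gasket \<xi>)" for \<tau> \<xi> \<eta> a b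
    using that dihedral_point cls[OF that(1,2)] dihedral_cell_adj by (fastforce simp: gasket_def)
  have cof': "cofinal_seqs \<xi> (inv \<sigma> \<circ> \<eta>)"
    using compose[OF cof, of "inv \<sigma>"] cofinal_sym by (simp add: inv)
  note \<sigma>' = dihedral_inv[OF \<sigma>]
  show ?thesis
    unfolding gasket_iso_def
    using verts[OF \<sigma> cof] verts[OF \<sigma>' cof'] edges[OF \<sigma> cof] edges[OF \<sigma>' cof']
    by (auto simp: image_image inv)
qed

text \<open>The isomorphism of gaskets yields a permutation for the sequences without their first letters, which
makes no difference to cofinality.\<close>

theorem gasket_iso_iff:
  assumes "\<xi> \<in> seqs"
  shows "(\<exists>\<phi> \<psi>. gasket_iso \<xi> \<eta> \<phi> \<psi>) \<longleftrightarrow> (\<exists>\<sigma>\<in>dihedral r. cofinal_seqs \<eta> (\<sigma> \<circ> \<xi>))"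
proof
  assume "\<exists>\<phi> \<psi>. gasket_iso \<xi> \<eta> \<phi> \<psi>"
  then obtain \<sigma> where "\<sigma> \<in> dihedral r" "cofinal_seqs (tail \<eta>) (\<sigma> \<circ> tail \<xi>)"
    using gasket_iso_imp_address_iso address_iso_imp_dihedral tail_seqs[OF assms] by metis
  moreover have "\<sigma> \<circ> tail \<xi> = tail (\<sigma> \<circ> \<xi>)" by (auto simp: tail_def)
  ultimately show "\<exists>\<sigma>\<in>dihedral r. cofinal_seqs \<eta> (\<sigma> \<circ> \<xi>)"
    using cofinal_tail by metis
qed (use dihedral_imp_gasket_iso in blast)

end

section \<open>Strong limits of graphs\<close>

lemma path_dist_le: "(u, v) \<in> edges G ^^ n \<Longrightarrow> path_dist G u v \<le> n"
  unfolding path_dist_def by (rule Least_le)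

lemma path_dist_attained: "(u, v) \<in> (edges G)\<^sup>* \<Longrightarrow> (u, v) \<in> edges G ^^ path_dist G u v"
  unfolding path_dist_def by (rule LeastI_ex) (simp add: rtrancl_power)

lemma path_dist_self [simp]: "path_dist G u u = 0"
  using path_dist_le[of u u 0 G] by simp

lemma path_dist_eq_0: "(u, v) \<in> (edges G)\<^sup>* \<Longrightarrow> path_dist G u v = 0 \<longleftrightarrow> u = v"
  using path_dist_attained[of u v G] by auto

lemma path_dist_triangle:
  assumes "(u, v) \<in> (edges G)\<^sup>*" "(v, w) \<in> (edges G)\<^sup>*"
  shows "path_dist G u w \<le> path_dist G u v + path_dist G v w"
  using relpow_trans[OF path_dist_attained[OF assms(1)] path_dist_attained[OF assms(2)]] path_dist_le by metis

lemma edge_iff_path_dist: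
  assumes "simple_graph G" "(u, v) \<in> (edges G)\<^sup>*"
  shows "(u, v) \<in> edges G \<longleftrightarrow> path_dist G u v = 1"
proof
  assume e: "(u, v) \<in> edges G"
  then have "u \<noteq> v" using assms(1) by (auto simp: simple_graph_def irrefl_def)
  then have "path_dist G u v \<noteq> 0" using path_dist_eq_0[OF assms(2)] by simp
  moreover have "path_dist G u v \<le> 1" using e by (intro path_dist_le) simp
  ultimately show "path_dist G u v = 1" by simp
next
  assume "path_dist G u v = 1"
  then show "(u, v) \<in> edges G" using path_dist_attained[OF assms(2)] by simp
qed

lemma sym_relpow:
  assumes "sym R" shows "(a, b) \<in> R ^^ n \<Longrightarrow> (b, a) \<in> R ^^ n"
proof (induction n arbitrary: b)
  case (Suc n)
  then obtain c where "(a, c) \<in> R ^^ n" "(c, b) \<in> R" by auto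
  then show ?case using Suc.IH assms by (meson relpow_Suc_I2 symD)
qed auto

lemma path_dist_sym: 
  assumes "simple_graph G" shows "path_dist G u v = path_dist G v u"
  unfolding path_dist_def using sym_relpow[of "edges G"] assms by (metis simple_graph_def)

lemma finite_graph_ball:
  assumes "connected_graph G" "p \<in> verts G" "\<And>a. finite {b. (a, b) \<in> edges G}"
  shows "finite (graph_ball G p R)"
proof -
  have fin: "finite {b. (p, b) \<in> edges G ^^ n}" for n
  proof (induction n)
    case (Suc n)
    have "{b. (p, b) \<in> edges G ^^ Suc n} = (\<Union>c\<in>{c. (p, c) \<in> edges G ^^ n}. {b. (c, b) \<in> edges G})" by auto
    then show ?case using Suc assms(3) by simp
  qed simp
  have "graph_ball G p R \<subseteq> (\<Union>n\<le>nat \<lceil>R\<rceil>. {b. (p, b) \<in> edges G ^^ n})"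
  proof
    fix b assume b: "b \<in> graph_ball G p R"
    then have "(p, b) \<in> edges G ^^ path_dist G p b"
      using assms by (intro path_dist_attained) (auto simp: graph_ball_def connected_graph_def)
    moreover have "path_dist G p b \<le> nat \<lceil>R\<rceil>" using b unfolding graph_ball_def by (auto simp: le_nat_iff) linarith
    ultimately show "b \<in> (\<Union>n\<le>nat \<lceil>R\<rceil>. {b. (p, b) \<in> edges G ^^ n})" by blast
  qed
  then show ?thesis by (rule finite_subset) (simp add: fin)
qed

lemma hom_relpow:
  assumes "\<And>u v. (u, v) \<in> E \<Longrightarrow> (f u, f v) \<in> F" "(u, v) \<in> E ^^ n"
  shows "(f u, f v) \<in> F ^^ n"
  using assms(2) by (induction n arbitrary: v) (use assms(1) in auto)

text \<open>If the graphs embed into \<open>X\<close>, preserving edges and base points, and each vertex and each edge of \<open>X\<close> is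
eventually covered, then they converge strongly to \<open>X\<close>. No estimate of distances is needed: by local
finiteness the ball of radius \<open>3 R\<close> has finitely many edges, all covered from some index on, and
geodesics between points of the ball of radius \<open>R\<close> stay in that larger ball, so they lift.\<close>

theorem strongly_converges_exhaustion:
  fixes Xs :: "nat \<Rightarrow> 'v graph" and X :: "'w graph" and \<iota> :: "nat \<Rightarrow> 'v \<Rightarrow> 'w"
  assumes simple: "simple_graph X"
    and locally_finite: "\<And>a. finite {b. (a, b) \<in> edges X}"
    and ps: "\<And>m. 1 \<le> m \<Longrightarrow> ps m \<in> verts (Xs m) \<and> \<iota> m (ps m) = p"
    and conn: "\<And>m. 1 \<le> m \<Longrightarrow> connected_graph (Xs m)"
    and wf: "\<And>m. 1 \<le> m \<Longrightarrow> edges (Xs m) \<subseteq> verts (Xs m) \<times> verts (Xs m)"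
    and inj: "\<And>m. 1 \<le> m \<Longrightarrow> inj_on (\<iota> m) (verts (Xs m))"
    and into: "\<And>m u. 1 \<le> m \<Longrightarrow> u \<in> verts (Xs m) \<Longrightarrow> \<iota> m u \<in> verts X"
    and hom: "\<And>m u v. 1 \<le> m \<Longrightarrow> (u, v) \<in> edges (Xs m) \<Longrightarrow> (\<iota> m u, \<iota> m v) \<in> edges X"
    and verts_exhausted: "\<And>a. a \<in> verts X \<Longrightarrow> \<forall>\<^sub>F m in sequentially. a \<in> \<iota> m ` verts (Xs m)"
    and edges_exhausted: "\<And>a b. (a, b) \<in> edges X \<Longrightarrow>
          \<forall>\<^sub>F m in sequentially. \<exists>u v. (u, v) \<in> edges (Xs m) \<and> \<iota> m u = a \<and> \<iota> m v = b"
  shows "strongly_converges Xs ps X p"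
proof -
  have p: "p \<in> verts X" using ps[of 1] into[of 1] by force
  have connX: "connected_graph X"
    unfolding connected_graph_def
  proof (intro ballI)
    fix a b assume "a \<in> verts X" "b \<in> verts X"
    then have "\<forall>\<^sub>F m in sequentially. a \<in> \<iota> m ` verts (Xs m) \<and> b \<in> \<iota> m ` verts (Xs m) \<and> 1 \<le> m"
      by (intro eventually_conj verts_exhausted eventually_ge_at_top)
    then obtain m u v where m: "1 \<le> m" "u \<in> verts (Xs m)" "v \<in> verts (Xs m)" "\<iota> m u = a" "\<iota> m v = b"
      using eventually_happens'[OF sequentially_bot] by fastforce
    then have "(u, v) \<in> (edges (Xs m))\<^sup>*" using conn by (simp add: connected_graph_def)
    then show "(a, b) \<in> (edges X)\<^sup>*"
      using hom_relpow[of "edges (Xs m)" "\<iota> m" "edges X"] hom[OF m(1)] m by (metis rtrancl_power)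
  qed
  have reach: "(a, b) \<in> (edges X)\<^sup>*" if "a \<in> verts X" "b \<in> verts X" for a b
    using connX that by (simp add: connected_graph_def)
  have "\<exists>M>0. \<forall>m>M. \<exists>\<phi>. pointed_ball_isometry \<phi> (Xs m) (ps m) X p R" if "R > 0" for R
  proof -
    define k where "k = nat \<lceil>R\<rceil>"
    have k: "d \<le> k" if "real d \<le> R" for d using that unfolding k_def by (auto simp: le_nat_iff) linarith
    define B where "B = graph_ball X p (real (3 * k))"
    have B: "a \<in> B" if "a \<in> verts X" "path_dist X p a \<le> 3 * k" for a
      using that by (simp only: B_def graph_ball_def mem_Collect_eq of_nat_le_iff simp_thms)
    have "finite B" unfolding B_def by (rule finite_graph_ball[OF connX p locally_finite])
    then have "finite (edges X \<inter> B \<times> B)" by simp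
    then have "\<forall>\<^sub>F m in sequentially. \<forall>(a, b)\<in>edges X \<inter> B \<times> B. \<exists>u v. (u, v) \<in> edges (Xs m) \<and> \<iota> m u = a \<and> \<iota> m v = b"
      by (rule eventually_ball_finite) (use edges_exhausted in auto)
    then obtain M where "\<forall>m\<ge>M. \<forall>(a, b)\<in>edges X \<inter> B \<times> B. \<exists>u v. (u, v) \<in> edges (Xs m) \<and> \<iota> m u = a \<and> \<iota> m v = b"
      unfolding eventually_sequentially by blast
    then have M: "\<exists>u v. (u, v) \<in> edges (Xs m) \<and> \<iota> m u = a \<and> \<iota> m v = b"
      if "M \<le> m" "(a, b) \<in> edges X \<inter> B \<times> B" for m a b using that by (auto dest!: spec bspec)
    have "pointed_ball_isometry (\<iota> m) (Xs m) (ps m) X p R" if "Suc M < m" for m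
    proof -
      have m: "1 \<le> m" "M \<le> m" using that by auto
      have reach_m: "(u, v) \<in> (edges (Xs m))\<^sup>*" if "u \<in> verts (Xs m)" "v \<in> verts (Xs m)" for u v
        using conn[OF m(1)] that by (simp add: connected_graph_def)
      have lift: "\<exists>v\<in>verts (Xs m). \<iota> m v = b \<and> (u, v) \<in> edges (Xs m) ^^ n"
        if "(\<iota> m u, b) \<in> edges X ^^ n" "path_dist X p (\<iota> m u) + n \<le> 3 * k" "u \<in> verts (Xs m)" for u b n
        using that(1,2)
      proof (induction n arbitrary: b)
        case 0
        then show ?case using that(3) by auto
      next
        case (Suc n)
        then obtain c where c: "(\<iota> m u, c) \<in> edges X ^^ n" "(c, b) \<in> edges X" by auto
        then obtain v where v: "v \<in> verts (Xs m)" "\<iota> m v = c" "(u, v) \<in> edges (Xs m) ^^ n"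
          using Suc.IH Suc.prems by auto
        have cb: "c \<in> verts X" "b \<in> verts X" using c(2) simple by (auto simp: simple_graph_def)
        have iu: "\<iota> m u \<in> verts X" using into[OF m(1) that(3)] .
        have "path_dist X p c \<le> path_dist X p (\<iota> m u) + path_dist X (\<iota> m u) c"
          by (intro path_dist_triangle reach p iu cb)
        moreover have "path_dist X (\<iota> m u) c \<le> n" using c(1) by (rule path_dist_le)
        moreover have "path_dist X p b \<le> path_dist X p c + path_dist X c b"
          by (intro path_dist_triangle reach p cb)
        moreover have "path_dist X c b \<le> 1" using c(2) by (intro path_dist_le) simp
        ultimately have "c \<in> B" "b \<in> B" using B cb Suc.prems by auto
        then obtain v' w where w: "(v', w) \<in> edges (Xs m)" "\<iota> m v' = c" "\<iota> m w = b"
          using M[OF m(2)] c(2) by blast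
        have "v' \<in> verts (Xs m)" "w \<in> verts (Xs m)" using w(1) wf[OF m(1)] by auto
        then have "v' = v" using inj_onD[OF inj[OF m(1)]] v w by metis
        then show ?case using v w \<open>w \<in> verts (Xs m)\<close> by auto
      qed
      have contract: "path_dist X (\<iota> m u) (\<iota> m v) \<le> path_dist (Xs m) u v"
        if "u \<in> verts (Xs m)" "v \<in> verts (Xs m)" for u v
        using hom_relpow[OF hom[OF m(1)] path_dist_attained[OF reach_m[OF that]]] by (rule path_dist_le)
      note pm = ps[OF m(1)]
      have to_ball: "\<iota> m u \<in> graph_ball X p R" if "u \<in> graph_ball (Xs m) (ps m) R" for u
        using that contract[of "ps m" u] pm into[OF m(1)] by (auto simp: graph_ball_def)
      have from_ball: "\<exists>u\<in>graph_ball (Xs m) (ps m) R. \<iota> m u = b" if "b \<in> graph_ball X p R" for b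
      proof -
        have b: "b \<in> verts X" "real (path_dist X p b) \<le> R" using that by (auto simp: graph_ball_def)
        have "(\<iota> m (ps m), b) \<in> edges X ^^ path_dist X p b"
          using path_dist_attained[OF reach[OF p b(1)]] pm by simp
        moreover have "path_dist X p (\<iota> m (ps m)) + path_dist X p b \<le> 3 * k" using pm k[OF b(2)] by simp
        ultimately obtain u where u: "u \<in> verts (Xs m)" "\<iota> m u = b" "(ps m, u) \<in> edges (Xs m) ^^ path_dist X p b"
          using lift pm by blast
        then have "real (path_dist (Xs m) (ps m) u) \<le> R" using path_dist_le[OF u(3)] b(2) by linarith
        then show ?thesis using u by (auto simp: graph_ball_def)
      qed
      have isometry: "path_dist X (\<iota> m u) (\<iota> m v) = path_dist (Xs m) u v"
        if u: "u \<in> graph_ball (Xs m) (ps m) R" and v: "v \<in> graph_ball (Xs m) (ps m) R" for u v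
      proof (rule antisym)
        have uv: "u \<in> verts (Xs m)" "v \<in> verts (Xs m)" using u v by (auto simp: graph_ball_def)
        then show "path_dist X (\<iota> m u) (\<iota> m v) \<le> path_dist (Xs m) u v" by (rule contract)
        let ?a = "\<iota> m u" and ?b = "\<iota> m v"
        have ab: "?a \<in> verts X" "?b \<in> verts X" "path_dist X p ?a \<le> k" "path_dist X p ?b \<le> k"
          using to_ball[OF u] to_ball[OF v] k by (auto simp: graph_ball_def)
        have "path_dist X ?a ?b \<le> path_dist X ?a p + path_dist X p ?b"
          by (intro path_dist_triangle reach p ab)
        then have "path_dist X p ?a + path_dist X ?a ?b \<le> 3 * k"
          using ab path_dist_sym[OF simple, of ?a p] by linarith
        then obtain v' where v': "v' \<in> verts (Xs m)" "\<iota> m v' = ?b" "(u, v') \<in> edges (Xs m) ^^ path_dist X ?a ?b"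
          using lift[OF path_dist_attained[OF reach[OF ab(1,2)]]] uv by blast
        then have "v' = v" using inj_onD[OF inj[OF m(1)]] uv by metis
        then show "path_dist (Xs m) u v \<le> path_dist X ?a ?b" using path_dist_le[OF v'(3)] by simp
      qed
      have "inj_on (\<iota> m) (graph_ball (Xs m) (ps m) R)"
        by (rule inj_on_subset[OF inj[OF m(1)]]) (auto simp: graph_ball_def)
      moreover have "\<iota> m ` graph_ball (Xs m) (ps m) R = graph_ball X p R"
        using to_ball from_ball by blast
      ultimately show ?thesis using isometry pm unfolding pointed_ball_isometry_def bij_betw_def by blast
    qed
    then show ?thesis by (intro exI[of _ "Suc M"]) auto
  qed
  then show ?thesis using simple connX p by (simp add: strongly_converges_def)
qed

lemma pointed_ball_isometry_through:
  assumes \<phi>: "pointed_ball_isometry \<phi> G o1 X p R" and \<psi>: "pointed_ball_isometry \<psi> G o1 Y q R"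
    and "o1 \<in> graph_ball G o1 R"
  shows "\<exists>\<chi>. pointed_ball_isometry \<chi> X p Y q R"
proof -
  let ?i = "inv_into (graph_ball G o1 R) \<phi>"
  have b1: "bij_betw \<phi> (graph_ball G o1 R) (graph_ball X p R)" and b2: "bij_betw \<psi> (graph_ball G o1 R) (graph_ball Y q R)"
    using \<phi> \<psi> by (auto simp: pointed_ball_isometry_def)
  have bi: "bij_betw ?i (graph_ball X p R) (graph_ball G o1 R)" using b1 by (rule bij_betw_inv_into)
  have "bij_betw (\<psi> \<circ> ?i) (graph_ball X p R) (graph_ball Y q R)" using bi b2 by (rule bij_betw_trans)
  moreover have "path_dist Y ((\<psi> \<circ> ?i) u) ((\<psi> \<circ> ?i) v) = path_dist X u v"
    if uv: "u \<in> graph_ball X p R" "v \<in> graph_ball X p R" for u v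
  proof -
    have i: "?i u \<in> graph_ball G o1 R" "?i v \<in> graph_ball G o1 R" using bi uv by (auto dest: bij_betwE)
    have "\<phi> (?i u) = u" "\<phi> (?i v) = v" using b1 uv by (auto simp: bij_betw_inv_into_right)
    then have "path_dist X u v = path_dist G (?i u) (?i v)" using \<phi> i unfolding pointed_ball_isometry_def by metis
    then show ?thesis using \<psi> i unfolding pointed_ball_isometry_def by simp
  qed
  moreover have "?i p = o1" using \<phi> assms(3) by (metis pointed_ball_isometry_def bij_betw_inv_into_left)
  then have "(\<psi> \<circ> ?i) p = q" using \<psi> by (simp add: pointed_ball_isometry_def)
  ultimately show ?thesis unfolding pointed_ball_isometry_def by blast
qed

text \<open>Balls of every radius of the two limits are isometric, but the isometries \<open>\<psi> n\<close> need not extend each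
other. As balls of \<open>Y\<close> are finite, the images of one vertex have a constant subsequence, and a
diagonal subsequence is eventually constant at every vertex; its pointwise limit \<open>\<chi>\<close> is an isometry.
It is onto because the preimages of \<open>w\<close> under the \<open>\<psi> n\<close> all lie in one finite ball, on which \<open>\<psi> n\<close>
equals \<open>\<chi>\<close> for a suitable \<open>n\<close>.\<close>

theorem strong_limit_unique:
  fixes X :: "nat graph" and Y :: "'w graph"
  assumes X: "strongly_converges Xs ps X p" and Y: "strongly_converges Xs ps Y q"
    and base: "\<And>m. 1 \<le> m \<Longrightarrow> ps m \<in> verts (Xs m)"
    and locally_finite: "\<And>a. finite {b. (a, b) \<in> edges Y}"
  shows "isomorphic X Y"
proof -
  have sX: "simple_graph X" and cX: "connected_graph X" and p: "p \<in> verts X" using X by (auto simp: strongly_converges_def)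
  have sY: "simple_graph Y" and cY: "connected_graph Y" and q: "q \<in> verts Y" using Y by (auto simp: strongly_converges_def)
  have reachX: "(a, b) \<in> (edges X)\<^sup>*" if "a \<in> verts X" "b \<in> verts X" for a b using cX that by (simp add: connected_graph_def)
  have reachY: "(a, b) \<in> (edges Y)\<^sup>*" if "a \<in> verts Y" "b \<in> verts Y" for a b using cY that by (simp add: connected_graph_def)
  have "\<exists>\<chi>. pointed_ball_isometry \<chi> X p Y q (real (Suc n))" for n
  proof -
    have "real (Suc n) > 0" by simp
    then obtain M1 M2 where M: "\<And>m. M1 < m \<Longrightarrow> \<exists>\<phi>. pointed_ball_isometry \<phi> (Xs m) (ps m) X p (real (Suc n))"
        "\<And>m. M2 < m \<Longrightarrow> \<exists>\<phi>. pointed_ball_isometry \<phi> (Xs m) (ps m) Y q (real (Suc n))"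
      using X Y unfolding strongly_converges_def by blast
    let ?m = "Suc (M1 + M2)"
    have "ps ?m \<in> graph_ball (Xs ?m) (ps ?m) (real (Suc n))" using base[of ?m] by (simp add: graph_ball_def)
    then show ?thesis using M(1)[of ?m] M(2)[of ?m] pointed_ball_isometry_through by fastforce
  qed
  then obtain \<psi> where \<psi>: "\<And>n. pointed_ball_isometry (\<psi> n) X p Y q (real (Suc n))" by metis
  let ?d = "path_dist X p"
  have in_ball: "v \<in> graph_ball X p (real (Suc n))" if "v \<in> verts X" "?d v \<le> n" for v n
    using that by (simp add: graph_ball_def)
  have \<psi>_dist: "path_dist Y (\<psi> n u) (\<psi> n v) = path_dist X u v"
    if "u \<in> verts X" "?d u \<le> n" "v \<in> verts X" "?d v \<le> n" for u v n
    using \<psi>[of n] in_ball that unfolding pointed_ball_isometry_def by blast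
  have \<psi>_p: "\<psi> n p = q" for n using \<psi>[of n] by (simp add: pointed_ball_isometry_def)
  have \<psi>_verts: "\<psi> n v \<in> verts Y" if "v \<in> verts X" "?d v \<le> n" for v n
  proof -
    have "\<psi> n v \<in> graph_ball Y q (real (Suc n))"
      using \<psi>[of n] in_ball[OF that] unfolding pointed_ball_isometry_def by (blast dest: bij_betwE)
    then show ?thesis by (simp add: graph_ball_def)
  qed
  have \<psi>_q: "path_dist Y q (\<psi> n v) = ?d v" if "v \<in> verts X" "?d v \<le> n" for v n
    using \<psi>_dist[OF p _ that] \<psi>_p by simp
  \<comment> \<open>Only \<open>\<psi> n\<close> with \<open>n \<ge> ?d v\<close> is controlled at \<open>v\<close>, hence the restriction to \<open>{?d v..}\<close>.\<close>
  interpret subseqs "\<lambda>v s. v \<in> verts X \<longrightarrow> (\<exists>w. \<forall>k. \<psi> (s k) v = w)"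
  proof
    fix v and s :: "nat \<Rightarrow> nat" assume s: "strict_mono s"
    show "\<exists>r' :: nat \<Rightarrow> nat. strict_mono r' \<and> (v \<in> verts X \<longrightarrow> (\<exists>w. \<forall>k. \<psi> ((s \<circ> r') k) v = w))"
    proof (cases "v \<in> verts X")
      case True
      let ?A = "{?d v..}"
      have "(\<lambda>k. \<psi> (s k) v) ` ?A \<subseteq> graph_ball Y q (real (?d v))"
      proof
        fix w assume "w \<in> (\<lambda>k. \<psi> (s k) v) ` ?A"
        then obtain k where k: "?d v \<le> k" "w = \<psi> (s k) v" by auto
        then have "?d v \<le> s k" using seq_suble[OF s, of k] by simp
        then show "w \<in> graph_ball Y q (real (?d v))" using \<psi>_q[OF True] \<psi>_verts[OF True] k by (simp add: graph_ball_def)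
      qed
      then have "finite ((\<lambda>k. \<psi> (s k) v) ` ?A)" using finite_graph_ball[OF cY q locally_finite] finite_subset by blast
      then obtain k0 where inf: "infinite {k \<in> ?A. \<psi> (s k) v = \<psi> (s k0) v}"
        using pigeonhole_infinite[OF infinite_Ici] by blast
      let ?r = "enumerate {k \<in> ?A. \<psi> (s k) v = \<psi> (s k0) v}"
      have "strict_mono ?r" using inf by (rule strict_mono_enumerate)
      moreover have "\<psi> ((s \<circ> ?r) k) v = \<psi> (s k0) v" for k using enumerate_in_set[OF inf, of k] by simp
      ultimately show ?thesis by (intro exI[of _ ?r]) auto
    qed (auto intro: exI[of _ id] simp: strict_mono_def)
  qed
  let ?D = "\<lambda>n. \<psi> (diagseq n)"
  define \<chi> where "\<chi> = (\<lambda>v. ?D (Suc v) v)"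
  have \<chi>: "?D n v = \<chi> v" if v: "v \<in> verts X" and n: "Suc v \<le> n" for n v
  proof -
    have "v \<in> verts X \<longrightarrow> (\<exists>w. \<forall>k. \<psi> ((diagseq \<circ> (+) (Suc v)) k) v = w)"
      by (rule diagseq_holds) auto
    then obtain w where "\<And>k. \<psi> (diagseq (Suc v + k)) v = w" using v by auto
    from this[of 0] this[of "n - Suc v"] show ?thesis using n by (simp add: \<chi>_def)
  qed
  have diag_ge: "n \<le> diagseq n" for n using seq_suble[OF subseq_diagseq] .
  have \<chi>_dist: "path_dist Y (\<chi> u) (\<chi> v) = path_dist X u v" if uv: "u \<in> verts X" "v \<in> verts X" for u v
  proof -
    let ?n = "Suc (u + v + ?d u + ?d v)"
    have "?D ?n u = \<chi> u" "?D ?n v = \<chi> v" using \<chi> uv by auto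
    moreover have "?d u \<le> diagseq ?n" "?d v \<le> diagseq ?n" using diag_ge[of ?n] by auto
    ultimately show ?thesis using \<psi>_dist[of u "diagseq ?n" v] uv by simp
  qed
  have \<chi>_verts: "\<chi> v \<in> verts Y" if v: "v \<in> verts X" for v
  proof -
    let ?n = "Suc (v + ?d v)"
    have "?D ?n v = \<chi> v" "?d v \<le> diagseq ?n" using \<chi> v diag_ge[of ?n] by auto
    then show ?thesis using \<psi>_verts[OF v, of "diagseq ?n"] by simp
  qed
  have surj: "\<exists>v\<in>verts X. \<chi> v = w" if w: "w \<in> verts Y" for w
  proof -
    let ?e = "path_dist Y q w"
    have bij: "bij_betw (\<psi> n) (graph_ball X p (real (Suc n))) (graph_ball Y q (real (Suc n)))" for n
      using \<psi>[of n] by (simp add: pointed_ball_isometry_def)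
    have pre: "\<exists>v\<in>verts X. ?d v = ?e \<and> \<psi> n v = w" if "?e \<le> n" for n
    proof -
      have "w \<in> graph_ball Y q (real (Suc n))" using w that by (simp add: graph_ball_def)
      then have "w \<in> \<psi> n ` graph_ball X p (real (Suc n))" using bij[of n] by (simp only: bij_betw_def)
      then obtain v where v: "v \<in> graph_ball X p (real (Suc n))" "\<psi> n v = w" by (elim imageE) simp
      moreover have "path_dist Y (\<psi> n p) (\<psi> n v) = ?d v"
        by (rule \<psi>[of n, unfolded pointed_ball_isometry_def, THEN conjunct2, THEN conjunct1, rule_format])
          (use v(1) in_ball[OF p] in simp_all)
      ultimately show ?thesis using \<psi>_p by (auto simp: graph_ball_def)
    qed
    have "finite (graph_ball X p (real (Suc ?e)))"
      by (rule iffD2[OF bij_betw_finite[OF bij] finite_graph_ball[OF cY q locally_finite]])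
    then obtain N where N: "\<forall>v\<in>graph_ball X p (real (Suc ?e)). v \<le> N"
      by (auto simp only: finite_nat_set_iff_bounded_le)
    let ?n = "Suc (N + ?e)"
    have "?e \<le> diagseq ?n" using diag_ge[of ?n] by simp
    then obtain v where v: "v \<in> verts X" "?d v = ?e" "?D ?n v = w" using pre[of "diagseq ?n"] by auto
    then have "v \<le> N" using N by (simp add: graph_ball_def)
    then show ?thesis using v \<chi>[of v ?n] by auto
  qed
  have "inj_on \<chi> (verts X)"
  proof (rule inj_onI)
    fix u v assume uv: "u \<in> verts X" "v \<in> verts X" "\<chi> u = \<chi> v"
    then have "path_dist X u v = 0" using \<chi>_dist[OF uv(1,2)] by simp
    then show "u = v" using path_dist_eq_0[OF reachX[OF uv(1,2)]] by simp
  qed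
  moreover have "\<chi> ` verts X = verts Y" using \<chi>_verts surj by auto
  ultimately have "bij_betw \<chi> (verts X) (verts Y)" by (simp add: bij_betw_def)
  moreover have "(u, v) \<in> edges X \<longleftrightarrow> (\<chi> u, \<chi> v) \<in> edges Y" if "u \<in> verts X" "v \<in> verts X" for u v
    using edge_iff_path_dist[OF sX reachX[OF that]] edge_iff_path_dist[OF sY reachY[OF \<chi>_verts[OF that(1)] \<chi>_verts[OF that(2)]]]
      \<chi>_dist[OF that] by simp
  ultimately show ?thesis unfolding isomorphic_def graph_isomorphism_def by blast
qed

section \<open>The limit graph is the gasket\<close>

text \<open>Prepending a finite word \<open>w\<close> to an infinite word \<open>t\<close> places the \<open>k\<close>-th finite graph, \<open>k\<close> being the
length of \<open>w\<close>, into the gasket as the copy named \<open>t\<close>.\<close>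

primrec conc :: "nat list \<Rightarrow> (nat \<Rightarrow> nat) \<Rightarrow> nat \<Rightarrow> nat" where
  "conc [] t = t"
| "conc (i # w) t = cons i (conc w t)"

lemma conc_append: "conc (u @ v) t = conc u (conc v t)"
  by (induction u) auto

lemma conc_nth: "conc w t n = (if n < length w then w ! n else t (n - length w))"
  by (induction w arbitrary: n) (auto simp: cons_def split: nat.splits)

lemma conc_inject: 
  assumes "length u = length v" "conc u t = conc v t" shows "u = v"
  using assms(1) 
proof (rule nth_equalityI)
  fix n assume "n < length u"
  then show "u ! n = v ! n" using fun_cong[OF assms(2), of n] assms(1) by (simp add: conc_nth)
qed

definition graph_image :: "('v \<Rightarrow> 'w) \<Rightarrow> 'v graph \<Rightarrow> 'w graph" where
  "graph_image g G = \<lparr>verts = g ` verts G, edges = map_prod g g ` edges G\<rparr>"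

lemma isomorphic_sym: "isomorphic G H \<Longrightarrow> isomorphic H G"
  unfolding isomorphic_def
proof (elim exE)
  fix \<phi> assume \<phi>: "graph_isomorphism \<phi> G H"
  let ?\<psi> = "inv_into (verts G) \<phi>"
  have bij: "bij_betw \<phi> (verts G) (verts H)" using \<phi> by (simp add: graph_isomorphism_def)
  have "(u, v) \<in> edges H \<longleftrightarrow> (?\<psi> u, ?\<psi> v) \<in> edges G" if "u \<in> verts H" "v \<in> verts H" for u v
  proof -
    have "?\<psi> u \<in> verts G" "?\<psi> v \<in> verts G" "\<phi> (?\<psi> u) = u" "\<phi> (?\<psi> v) = v"
      using bij that bij_betw_inv_into[OF bij] by (auto simp: bij_betw_inv_into_right dest: bij_betwE)
    then show ?thesis using \<phi> unfolding graph_isomorphism_def by metis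
  qed
  then show "\<exists>\<psi>. graph_isomorphism \<psi> H G" 
    using bij_betw_inv_into[OF bij] unfolding graph_isomorphism_def by blast
qed

lemma isomorphic_trans:
  assumes "isomorphic G H" "isomorphic H K" shows "isomorphic G K"
proof -
  obtain \<phi> \<psi> where \<phi>: "graph_isomorphism \<phi> G H" and \<psi>: "graph_isomorphism \<psi> H K"
    using assms by (auto simp: isomorphic_def)
  have bij: "bij_betw \<phi> (verts G) (verts H)" "bij_betw \<psi> (verts H) (verts K)"
    using \<phi> \<psi> by (auto simp: graph_isomorphism_def)
  have "\<phi> u \<in> verts H" if "u \<in> verts G" for u using bij(1) that by (rule bij_betw_apply)
  then have "graph_isomorphism (\<psi> \<circ> \<phi>) G K"
    using \<phi> \<psi> bij_betw_trans[OF bij] by (simp add: graph_isomorphism_def)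
  then show ?thesis unfolding isomorphic_def by blast
qed

context polygon_gasket
begin

lemma conc_seqs: "conc w t \<in> seqs \<longleftrightarrow> set w \<subseteq> {..<r} \<and> t \<in> seqs"
  by (induction w) auto

lemma glue_at_conc:
  assumes "t \<in> seqs" "i < r"
  shows "glue_at (Suc m) i (conc (replicate (Suc m) (up i) @ [i]) t) (conc (replicate (Suc m) (dn (nx i)) @ [nx i]) t)"
proof (induction m)
  case 0
  then show ?case using glue_at_cons[of "cons i t" "cons (nx i) t" i] assms by simp
next
  case (Suc m)
  then show ?case using glue_at_cons_Suc by simp
qed

text \<open>The quantification over all \<open>t\<close> makes the induction pass through the rule that appends a letter.\<close>

lemma same_vertex_sound:
  assumes "same_vertex r u v"
  shows "length u = length v \<and> set u \<subseteq> {..<r} \<and> set v \<subseteq> {..<r} \<and>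
     (\<forall>t\<in>seqs. point (conc u t) = point (conc v t))"
  using assms
proof induction
  case (glue i k)
  define m where "m = k - 2"
  have m: "k - 1 = Suc m" using glue by (simp add: m_def)
  have e: "(i + corner r) mod r = up i" "(i + 1) mod r = nx i" "(i + 1 + corner' r) mod r = dn (nx i)"
    by (auto simp: up_def nx_def dn_def mod_simps)
  let ?u = "replicate (Suc m) (up i) @ [i]" and ?v = "replicate (Suc m) (dn (nx i)) @ [nx i]"
  have s: "set ?u \<subseteq> {..<r}" "set ?v \<subseteq> {..<r}" using glue by auto
  have "point (conc ?u t) = point (conc ?v t)" if "t \<in> seqs" for t
    using glue_at_conc[OF that glue(1), of m] s that unfolding point_eq_iff link_def conc_seqs by blast
  then show ?case using s unfolding e m by simp
qed (auto simp: conc_append)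

lemma same_vertex_append:
  "same_vertex r u v \<Longrightarrow> set w \<subseteq> {..<r} \<Longrightarrow> same_vertex r (u @ w) (v @ w)"
proof (induction w rule: rev_induct)
  case (snoc i w)
  then show ?case using same_vertex.copy[of r "u @ w" "v @ w" i] by simp
qed simp

lemma same_vertex_refl: "w \<noteq> [] \<Longrightarrow> set w \<subseteq> {..<r} \<Longrightarrow> same_vertex r w w"
  using same_vertex_append[OF same_vertex.letter] by (cases w) force+

lemma same_vertex_refl_words: "w \<in> words r k \<Longrightarrow> 1 \<le> k \<Longrightarrow> same_vertex r w w"
  by (rule same_vertex_refl) (auto simp: words_def)

lemma glue_at_conc_same_vertex:
  assumes u: "set u \<subseteq> {..<r}" "length u = length v" and g: "glue_at m i (conc u t) (conc v t)"
  shows "same_vertex r u v"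
proof -
  have i: "i < r" "1 \<le> m" using g by (auto simp: glue_at_def)
  have m: "m < length u"
  proof (rule ccontr)
    assume "\<not> m < length u"
    then have "conc u t m = conc v t m" using u by (simp add: conc_nth)
    then show False using g letter_neq(4)[OF i(1)] unfolding glue_at_def by metis
  qed
  define w where "w = drop (Suc m) u"
  have nth: "conc u t n = u ! n" "conc v t n = v ! n" if "n < length u" for n
    using that u by (auto simp: conc_nth)
  have u_eq: "u = (replicate m (up i) @ [i]) @ w"
  proof (rule nth_equalityI)
    fix n assume "n < length u"
    then show "u ! n = ((replicate m (up i) @ [i]) @ w) ! n"
      using g m nth[of n] by (cases n m rule: linorder_cases) (auto simp: glue_at_def nth_append w_def)
  qed (use m in \<open>auto simp: w_def\<close>)
  have v_eq: "v = (replicate m (dn (nx i)) @ [nx i]) @ w"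
  proof (rule nth_equalityI)
    fix n assume n: "n < length v"
    show "v ! n = ((replicate m (dn (nx i)) @ [nx i]) @ w) ! n"
    proof (cases n m rule: linorder_cases)
      case greater
      then have "conc u t n = conc v t n" using g by (auto simp: glue_at_def)
      then show ?thesis using greater n u nth[of n] by (simp add: nth_append w_def)
    qed (use g n m u nth[of n] in \<open>auto simp: glue_at_def nth_append w_def\<close>)
  qed (use m u in \<open>auto simp: w_def\<close>)
  have "same_vertex r (replicate m (up i) @ [i]) (replicate m (dn (nx i)) @ [nx i])"
    using same_vertex.glue[OF i(1), of "Suc m"] i(2) by (simp add: up_def nx_def dn_def mod_simps)
  moreover have "set w \<subseteq> {..<r}" using u(1) set_drop_subset[of "Suc m" u] by (simp add: w_def)
  ultimately have "same_vertex r ((replicate m (up i) @ [i]) @ w) ((replicate m (dn (nx i)) @ [nx i]) @ w)"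
    by (rule same_vertex_append)
  then show ?thesis by (simp only: u_eq[symmetric] v_eq[symmetric])
qed

text \<open>Words label the same vertex of a finite graph exactly if they do so in the gasket: linked words with
the same tail \<open>t\<close> differ only inside the finite part, so that the gluing which links them takes
place in the finite graph.\<close>

lemma same_vertex_iff:
  assumes u: "u \<in> words r k" and v: "v \<in> words r k" and k: "1 \<le> k" and t: "t \<in> seqs"
  shows "same_vertex r u v \<longleftrightarrow> point (conc u t) = point (conc v t)"
proof
  assume "point (conc u t) = point (conc v t)"
  then have "conc u t = conc v t \<or> link (conc u t) (conc v t)" by (simp add: point_eq_iff)
  then show "same_vertex r u v"
  proof
    assume "conc u t = conc v t"
    then have "u = v" using conc_inject u v by (auto simp: words_def)
    then show ?thesis using same_vertex_refl_words[OF u k] by simp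
  next
    assume "link (conc u t) (conc v t)"
    then show ?thesis
      using glue_at_conc_same_vertex[of u v] glue_at_conc_same_vertex[of v u] u v same_vertex.sym
      unfolding link_def words_def by auto
  qed
qed (use same_vertex_sound t in blast)

lemma vertex_eq_iff:
  assumes u: "u \<in> words r k" and v: "v \<in> words r k" and k: "1 \<le> k"
  shows "vertex r u = vertex r v \<longleftrightarrow> same_vertex r u v"
proof
  assume "vertex r u = vertex r v"
  moreover have "v \<in> vertex r v" using same_vertex_refl_words[OF v k] by (simp add: vertex_def)
  ultimately show "same_vertex r u v" by (auto simp: vertex_def)
next
  assume "same_vertex r u v"
  then show "vertex r u = vertex r v"
    unfolding vertex_def using same_vertex.trans same_vertex.sym by blast
qed

lemma label_edge_sound: 
  "label_edge r u v \<Longrightarrow> t \<in> seqs \<Longrightarrow> cell_adj (conc u t) (conc v t)"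
proof (induction arbitrary: t rule: label_edge.induct)
  case (cycle i j)
  then show ?case by (simp add: cell_adj_cons ring_adj_cycle_graph)
qed (simp add: conc_append)

lemma label_edge_Cons:
  assumes "ring_adj i j" "set w \<subseteq> {..<r}" shows "label_edge r (i # w) (j # w)"
  using assms(2)
proof (induction w rule: rev_induct)
  case Nil
  then show ?case using assms(1) label_edge.cycle by (simp add: ring_adj_cycle_graph)
next
  case (snoc k w)
  then show ?case using label_edge.copy[of r "i # w" "j # w" k] by simp
qed

lemma label_edge_complete:
  assumes u: "u \<in> words r k" and v: "v \<in> words r k" and k: "1 \<le> k" and a: "cell_adj (conc u t) (conc v t)"
  shows "label_edge r u v"
proof -
  obtain i u' j v' where uv: "u = i # u'" "v = j # v'" using u v k by (cases u; cases v) (auto simp: words_def)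
  then have "ring_adj i j" "conc u' t = conc v' t" using a by (auto simp: cell_adj_cons)
  moreover from this have "u' = v'" using conc_inject u v uv by (auto simp: words_def)
  ultimately show ?thesis using label_edge_Cons u uv by (auto simp: words_def)
qed

text \<open>By induction each copy is connected, and consecutive copies of the ring share a vertex.\<close>

lemma sierpinski_connected:
  assumes "1 \<le> k" shows "connected_graph (sierpinski r k)"
proof -
  let ?S = "{(u, v). label_edge r u v \<or> same_vertex r u v}"
  have step: "(u @ [i], v @ [i]) \<in> ?S\<^sup>*" if "(u, v) \<in> ?S\<^sup>*" "i < r" for u v i
    using that(1)
  proof (induction rule: rtrancl_induct)
    case (step v w)
    then have "(v @ [i], w @ [i]) \<in> ?S" using that(2) label_edge.copy same_vertex.copy by auto
    with step.IH show ?case by (rule rtrancl_into_rtrancl)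
  qed simp
  have words_conn: "(u, v) \<in> ?S\<^sup>*" if "u \<in> words r (Suc n)" "v \<in> words r (Suc n)" for n u v
    using that
  proof (induction n arbitrary: u v)
    case 0
    then obtain i j where ij: "u = [i]" "v = [j]" "i < r" "j < r" 
      by (auto simp: words_def length_Suc_conv)
    have "([i], [j]) \<in> ?S\<^sup>*"
      using ij(3) rtrancl_refl _ ij(4)
    proof (rule nx_induct)
      fix k assume k: "k < r" "([i], [k]) \<in> ?S\<^sup>*"
      have "label_edge r [k] [nx k]" using label_edge_Cons[OF ring_adj_nx[OF k(1)], of "[]"] by simp
      then show "([i], [nx k]) \<in> ?S\<^sup>*" using k(2) by (auto intro: rtrancl_into_rtrancl)
    qed
    then show ?case using ij by simp
  next
    case (Suc n)
    obtain u' i where u: "u = u' @ [i]" "u' \<in> words r (Suc n)" "i < r"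
      using Suc.prems(1) by (cases u rule: rev_cases) (auto simp: words_def)
    obtain v' j where v: "v = v' @ [j]" "v' \<in> words r (Suc n)" "j < r"
      using Suc.prems(2) by (cases v rule: rev_cases) (auto simp: words_def)
    have in_copy: "(w @ [k], w' @ [k]) \<in> ?S\<^sup>*" if "w \<in> words r (Suc n)" "w' \<in> words r (Suc n)" "k < r" for w w' k
      using step Suc.IH that by blast
    have rep: "replicate (Suc n) a \<in> words r (Suc n)" if "a < r" for a using that by (auto simp: words_def)
    have "\<forall>v'\<in>words r (Suc n). (u, v' @ [j]) \<in> ?S\<^sup>*"
      using u(3) _ _ v(3)
    proof (rule nx_induct)
      show "\<forall>v'\<in>words r (Suc n). (u, v' @ [i]) \<in> ?S\<^sup>*" using in_copy u by blast
      fix k assume k: "k < r" "\<forall>v'\<in>words r (Suc n). (u, v' @ [k]) \<in> ?S\<^sup>*"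
      show "\<forall>v'\<in>words r (Suc n). (u, v' @ [nx k]) \<in> ?S\<^sup>*"
      proof
        fix w assume w: "w \<in> words r (Suc n)"
        have "same_vertex r (replicate (Suc n) (up k) @ [k]) (replicate (Suc n) (dn (nx k)) @ [nx k])"
          using same_vertex.glue[OF k(1), of "Suc (Suc n)"] by (simp add: up_def nx_def dn_def mod_simps)
        then have "(replicate (Suc n) (up k) @ [k], replicate (Suc n) (dn (nx k)) @ [nx k]) \<in> ?S\<^sup>*" by blast
        moreover have "(replicate (Suc n) (dn (nx k)) @ [nx k], w @ [nx k]) \<in> ?S\<^sup>*"
          by (intro in_copy rep w letter_less)
        moreover have "(u, replicate (Suc n) (up k) @ [k]) \<in> ?S\<^sup>*"
          by (rule bspec[OF k(2) rep[OF letter_less(2)]])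
        ultimately show "(u, w @ [nx k]) \<in> ?S\<^sup>*" by (meson rtrancl_trans)
      qed
    qed
    then show ?case using v by blast
  qed
  have to_graph: "v \<in> words r k \<and> (vertex r u, vertex r v) \<in> (edges (sierpinski r k))\<^sup>*"
    if "(u, v) \<in> ?S\<^sup>*" "u \<in> words r k" for u v
    using that
  proof (induction rule: rtrancl_induct)
    case (step v w)
    have r0: "(\<lambda>n. 0) \<in> seqs" using r_ge_3 by (simp add: seqs_def)
    have v: "v \<in> words r k" "(vertex r u, vertex r v) \<in> (edges (sierpinski r k))\<^sup>*" using step by auto
    from step(2) consider "label_edge r v w" | "same_vertex r v w" by blast
    then show ?case
    proof cases
      case 1
      have "length v = length w" using 1 by induction auto
      moreover have "set w \<subseteq> {..<r}" using label_edge_sound[OF 1 r0] conc_seqs by (simp add: cell_adj_def)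
      ultimately have "w \<in> words r k" using v by (simp add: words_def)
      moreover from this have "(vertex r v, vertex r w) \<in> edges (sierpinski r k)"
        using 1 v by (auto simp: sierpinski_def)
      ultimately show ?thesis using v by (meson rtrancl.rtrancl_into_rtrancl)
    next
      case 2
      then have "w \<in> words r k" using same_vertex_sound[OF 2] v by (simp add: words_def)
      then show ?thesis using v 2 vertex_eq_iff[OF v(1) _ assms] by metis
    qed
  qed simp
  obtain n where "k = Suc n" using assms by (cases k) auto
  then have "(vertex r u, vertex r v) \<in> (edges (sierpinski r k))\<^sup>*" if "u \<in> words r k" "v \<in> words r k" for u v
    using to_graph words_conn that by blast
  then show ?thesis by (auto simp: connected_graph_def sierpinski_def)
qed

definition shift :: "nat \<Rightarrow> (nat \<Rightarrow> nat) \<Rightarrow> nat \<Rightarrow> nat" where "shift m x = (\<lambda>n. x (n + m))"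

lemma shift_seqs: "x \<in> seqs \<Longrightarrow> shift m x \<in> seqs" by (simp add: shift_def seqs_def)

lemma seq_prefix_words: "x \<in> seqs \<Longrightarrow> seq_prefix x m \<in> words r m"
  by (auto simp: seq_prefix_def words_def seqs_def)

lemma conc_prefix_shift: "(\<And>n. m \<le> n \<Longrightarrow> x n = \<xi> n) \<Longrightarrow> conc (seq_prefix x m) (shift m \<xi>) = x"
  by (rule ext) (auto simp: conc_nth seq_prefix_def shift_def)

lemma conc_shift_class:
  assumes "\<xi> \<in> seqs" "w \<in> words r m" shows "conc w (shift m \<xi>) \<in> cofinality_class \<xi>"
proof -
  have "conc w (shift m \<xi>) n = \<xi> n" if "m \<le> n" for n using assms that by (auto simp: conc_nth words_def shift_def)
  then show ?thesis using assms shift_seqs conc_seqs by (auto simp: cofinality_class_def cofinal_seqs_def words_def)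
qed

lemma class_eventually_prefix:
  assumes "x \<in> cofinality_class \<xi>"
  shows "\<forall>\<^sub>F m in sequentially. 1 \<le> m \<and> seq_prefix x m \<in> words r m \<and> conc (seq_prefix x m) (shift m \<xi>) = x"
proof -
  obtain N where N: "\<And>n. N \<le> n \<Longrightarrow> x n = \<xi> n" using assms by (auto simp: cofinality_class_def cofinal_seqs_def)
  show ?thesis
    unfolding eventually_sequentially
    using seq_prefix_words[OF class_seqs[OF assms]] conc_prefix_shift[of _ x \<xi>] N
    by (intro exI[of _ "Suc N"]) auto
qed

text \<open>The copy of the \<open>m\<close>-th finite graph that contains the base point.\<close>

definition embed :: "(nat \<Rightarrow> nat) \<Rightarrow> nat \<Rightarrow> nat list set \<Rightarrow> (nat \<Rightarrow> nat) set" where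
  "embed \<xi> m a = point (conc (SOME w. w \<in> a) (shift m \<xi>))"

lemma embed_vertex:
  assumes "\<xi> \<in> seqs" "w \<in> words r m" "1 \<le> m"
  shows "embed \<xi> m (vertex r w) = point (conc w (shift m \<xi>))"
proof -
  have "w \<in> vertex r w" using same_vertex_refl_words[OF assms(2,3)] by (simp add: vertex_def)
  then have "(SOME w'. w' \<in> vertex r w) \<in> vertex r w" by (rule someI)
  then have "same_vertex r w (SOME w'. w' \<in> vertex r w)" by (simp add: vertex_def)
  then show ?thesis using same_vertex_sound shift_seqs[OF assms(1)] unfolding embed_def by metis
qed

lemma gasket_simple: "simple_graph (gasket \<xi>)"
  unfolding simple_graph_def
proof (intro conjI)
  have closed: "y \<in> cofinality_class \<xi>" if "x \<in> cofinality_class \<xi>" "cell_adj x y" for x y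
    using class_hadj that by (simp add: hadj_def)
  show "edges (gasket \<xi>) \<subseteq> verts (gasket \<xi>) \<times> verts (gasket \<xi>)"
    using closed by (auto simp: gasket_def)
  show "sym (edges (gasket \<xi>))"
    using closed cell_adj_sym by (fastforce simp: gasket_def sym_def)
  have "point x \<noteq> point y" if "cell_adj x y" for x y
    using that point_inj_cell cell_adj_neq unfolding cell_adj_def by blast
  then show "irrefl (edges (gasket \<xi>))"
    by (auto simp: gasket_def irrefl_def)
qed

lemma gasket_locally_finite: "finite {b. (a, b) \<in> edges (gasket \<xi>)}"
proof (rule finite_subset)
  show "{b. (a, b) \<in> edges (gasket \<xi>)} \<subseteq> (\<Union>x\<in>{x. a = point x}. (\<lambda>j. point (cons j (tail x))) ` {..<r})"
  proof
    fix b assume "b \<in> {b. (a, b) \<in> edges (gasket \<xi>)}"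
    then obtain x y where xy: "a = point x" "b = point y" "cell_adj x y" by (auto simp: gasket_def)
    from xy(3) obtain u i j where "x = cons i u" "y = cons j u" "ring_adj i j" by (elim cell_adjE)
    then show "b \<in> (\<Union>x\<in>{x. a = point x}. (\<lambda>j. point (cons j (tail x))) ` {..<r})"
      using xy by (auto simp: ring_adj_def intro!: exI[of _ x])
  qed
  have "finite {x. a = point x}"
  proof (cases "\<exists>z. a = point z")
    case True
    then obtain z where z: "a = point z" by blast
    have "{x. a = point x} = point z" 
      unfolding z by (subst point_eq_iff) (auto simp: point_def)
    moreover have "finite (point z)"
    proof (cases "\<exists>w. link z w")
      case True
      then show ?thesis using point_link by force
    qed (simp add: point_def)
    ultimately show ?thesis by simp
  qed simp
  then show "finite (\<Union>x\<in>{x. a = point x}. (\<lambda>j. point (cons j (tail x))) ` {..<r})" by blast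
qed

lemma gasket_countable: "countable (verts (gasket \<xi>))"
proof -
  have "cofinality_class \<xi> \<subseteq> (\<Union>m. range (\<lambda>w. conc w (shift m \<xi>)))"
  proof
    fix x assume "x \<in> cofinality_class \<xi>"
    from eventually_happens'[OF sequentially_bot class_eventually_prefix[OF this]]
    obtain m where "conc (seq_prefix x m) (shift m \<xi>) = x" by blast
    then show "x \<in> (\<Union>m. range (\<lambda>w. conc w (shift m \<xi>)))" by (metis UN_I UNIV_I rangeI)
  qed
  then have "countable (cofinality_class \<xi>)" by (rule countable_subset) simp
  then show ?thesis by (simp add: gasket_def)
qed

text \<open>The injective relabelling \<open>g\<close> is there because the limit has to be realised on the natural numbers.\<close>

theorem gasket_strong_limit:
  assumes \<xi>: "\<xi> \<in> seqs" and g: "inj_on g (verts (gasket \<xi>))"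
  shows "strongly_converges (sierpinski r) (\<lambda>k. vertex r (seq_prefix \<xi> k)) (graph_image g (gasket \<xi>)) (g (point \<xi>))"
proof (rule strongly_converges_exhaustion[where \<iota> = "\<lambda>m. g \<circ> embed \<xi> m"])
  let ?G = "gasket \<xi>" and ?X = "graph_image g (gasket \<xi>)"
  have wfG: "edges ?G \<subseteq> verts ?G \<times> verts ?G" using gasket_simple by (simp add: simple_graph_def)
  have g_eq: "g a = g b \<longleftrightarrow> a = b" if "a \<in> verts ?G" "b \<in> verts ?G" for a b
    using inj_on_eq_iff[OF g that] .
  show "simple_graph ?X"
    unfolding simple_graph_def
  proof (intro conjI)
    show "edges ?X \<subseteq> verts ?X \<times> verts ?X" using wfG by (auto simp: graph_image_def)
    show "sym (edges ?X)" using gasket_simple[of \<xi>] by (force simp: graph_image_def simple_graph_def sym_def)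
    have "g a \<noteq> g b" if "(a, b) \<in> edges ?G" for a b
      using that gasket_simple[of \<xi>] g_eq wfG by (auto simp: simple_graph_def irrefl_def)
    then show "irrefl (edges ?X)" by (auto simp: graph_image_def irrefl_def)
  qed
  show "finite {b. (a, b) \<in> edges ?X}" for a
  proof -
    have "finite {c. g c = a \<and> c \<in> verts ?G}"
    proof (cases "\<exists>c\<in>verts ?G. g c = a")
      case True
      then obtain c where "c \<in> verts ?G" "g c = a" by blast
      then have "{c. g c = a \<and> c \<in> verts ?G} \<subseteq> {c}" using g_eq by auto
      then show ?thesis using finite_subset by blast
    next
      case False
      then have "{c. g c = a \<and> c \<in> verts ?G} = {}" by blast
      then show ?thesis by (metis finite.emptyI)
    qed
    then have "finite (\<Union>c\<in>{c. g c = a \<and> c \<in> verts ?G}. g ` {b. (c, b) \<in> edges ?G})"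
      using gasket_locally_finite by blast
    moreover have "{b. (a, b) \<in> edges ?X} \<subseteq> (\<Union>c\<in>{c. g c = a \<and> c \<in> verts ?G}. g ` {b. (c, b) \<in> edges ?G})"
      using wfG by (auto simp: graph_image_def)
    ultimately show ?thesis by (rule rev_finite_subset)
  qed
  fix m :: nat
  have point_verts: "point x \<in> verts ?G" if "x \<in> cofinality_class \<xi>" for x using that by (simp add: gasket_def)
  {
    assume m: "1 \<le> m"
    note embed = embed_vertex[OF \<xi> _ m]
    have V: "verts (sierpinski r m) = vertex r ` words r m" by (simp add: sierpinski_def)
    have "conc (seq_prefix \<xi> m) (shift m \<xi>) = \<xi>" by (rule conc_prefix_shift) simp
    then show "vertex r (seq_prefix \<xi> m) \<in> verts (sierpinski r m) \<and> (g \<circ> embed \<xi> m) (vertex r (seq_prefix \<xi> m)) = g (point \<xi>)"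
      using embed[OF seq_prefix_words[OF \<xi>]] seq_prefix_words[OF \<xi>] by (simp add: V)
    show "connected_graph (sierpinski r m)" using sierpinski_connected[OF m] .
    show "edges (sierpinski r m) \<subseteq> verts (sierpinski r m) \<times> verts (sierpinski r m)"
      by (auto simp: sierpinski_def)
    have into: "embed \<xi> m a \<in> verts ?G" if "a \<in> verts (sierpinski r m)" for a
      using that embed conc_shift_class[OF \<xi>] by (auto simp: V gasket_def)
    show "(g \<circ> embed \<xi> m) u \<in> verts ?X" if "u \<in> verts (sierpinski r m)" for u
      using into that by (simp add: graph_image_def)
    have "inj_on (embed \<xi> m) (verts (sierpinski r m))"
    proof (rule inj_onI)
      fix a b assume "a \<in> verts (sierpinski r m)" "b \<in> verts (sierpinski r m)" and eq: "embed \<xi> m a = embed \<xi> m b"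
      then obtain u v where uv: "u \<in> words r m" "v \<in> words r m" "a = vertex r u" "b = vertex r v" by (auto simp: V)
      then have "point (conc u (shift m \<xi>)) = point (conc v (shift m \<xi>))" using eq embed by simp
      then show "a = b" using same_vertex_iff[OF uv(1,2) m shift_seqs[OF \<xi>]] vertex_eq_iff[OF uv(1,2) m] uv by simp
    qed
    then show "inj_on (g \<circ> embed \<xi> m) (verts (sierpinski r m))"
      by (rule comp_inj_on) (rule inj_on_subset[OF g], use into in auto)
    show "((g \<circ> embed \<xi> m) a, (g \<circ> embed \<xi> m) b) \<in> edges ?X" if "(a, b) \<in> edges (sierpinski r m)" for a b
    proof -
      from that obtain u v where uv: "u \<in> words r m" "v \<in> words r m" "a = vertex r u" "b = vertex r v" "label_edge r u v"
        by (auto simp: sierpinski_def)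
      have "cell_adj (conc u (shift m \<xi>)) (conc v (shift m \<xi>))"
        using label_edge_sound[OF uv(5) shift_seqs[OF \<xi>]] .
      then have "(point (conc u (shift m \<xi>)), point (conc v (shift m \<xi>))) \<in> edges ?G"
        unfolding gasket_def using conc_shift_class[OF \<xi> uv(1)] by auto
      then have "(embed \<xi> m a, embed \<xi> m b) \<in> edges ?G" using embed uv by simp
      then show ?thesis by (force simp: graph_image_def)
    qed
  }
  show "\<forall>\<^sub>F m in sequentially. a \<in> (g \<circ> embed \<xi> m) ` verts (sierpinski r m)" if a: "a \<in> verts ?X" for a
  proof -
    obtain x where x: "x \<in> cofinality_class \<xi>" "a = g (point x)" using a by (auto simp: graph_image_def gasket_def)
    from class_eventually_prefix[OF x(1)] show ?thesis
    proof eventually_elim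
      case (elim m)
      then have e: "embed \<xi> m (vertex r (seq_prefix x m)) = point x" using embed_vertex[OF \<xi>] by simp
      have "vertex r (seq_prefix x m) \<in> verts (sierpinski r m)" using elim by (simp add: sierpinski_def)
      then show ?case by (rule rev_image_eqI) (simp add: x e)
    qed
  qed
  show "\<forall>\<^sub>F m in sequentially. \<exists>u v. (u, v) \<in> edges (sierpinski r m) \<and> (g \<circ> embed \<xi> m) u = a \<and> (g \<circ> embed \<xi> m) v = b"
    if ab: "(a, b) \<in> edges ?X" for a b
  proof -
    obtain x y where xy: "x \<in> cofinality_class \<xi>" "cell_adj x y" "a = g (point x)" "b = g (point y)"
      using ab by (auto simp: graph_image_def gasket_def)
    have y: "y \<in> cofinality_class \<xi>" using class_hadj[OF xy(1)] xy(2) by (simp add: hadj_def)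
    from class_eventually_prefix[OF xy(1)] class_eventually_prefix[OF y] show ?thesis
    proof eventually_elim
      case (elim m)
      let ?u = "seq_prefix x m" and ?v = "seq_prefix y m"
      have "label_edge r ?u ?v" using label_edge_complete[of ?u m ?v "shift m \<xi>"] elim xy(2) by simp
      then have "(vertex r ?u, vertex r ?v) \<in> edges (sierpinski r m)" using elim by (auto simp: sierpinski_def)
      moreover have "embed \<xi> m (vertex r ?u) = point x" "embed \<xi> m (vertex r ?v) = point y"
        using embed_vertex[OF \<xi>] elim by auto
      ultimately show ?case using xy by (metis comp_apply)
    qed
  qed
qed

text \<open>A relabelled gasket shows that a strong limit on the natural numbers exists, so the chosen one is a
strong limit; uniqueness identifies it with the gasket itself.\<close>

theorem limit_graph_isomorphic_gasket:
  assumes \<xi>: "\<xi> \<in> seqs" shows "isomorphic (limit_graph r \<xi>) (gasket \<xi>)"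
proof -
  let ?g = "to_nat_on (verts (gasket \<xi>))" and ?ps = "\<lambda>k. vertex r (seq_prefix \<xi> k)"
  let ?X = "graph_image ?g (gasket \<xi>)"
  have inj: "inj_on ?g (verts (gasket \<xi>))" using gasket_countable by (rule inj_on_to_nat_on)
  have "strongly_converges (sierpinski r) ?ps ?X (?g (point \<xi>))"
    using gasket_strong_limit[OF \<xi> inj] .
  then have "\<exists>Z. case Z of (X :: nat graph, p) \<Rightarrow> strongly_converges (sierpinski r) ?ps X p" by blast
  then have "case pointed_limit r \<xi> of (X, p) \<Rightarrow> strongly_converges (sierpinski r) ?ps X p"
    unfolding pointed_limit_def by (rule someI_ex)
  then have lim: "strongly_converges (sierpinski r) ?ps (limit_graph r \<xi>) (snd (pointed_limit r \<xi>))"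
    by (simp add: limit_graph_def case_prod_beta)
  have G: "strongly_converges (sierpinski r) ?ps (graph_image id (gasket \<xi>)) (id (point \<xi>))"
    by (rule gasket_strong_limit[OF \<xi>]) simp
  have "graph_image id (gasket \<xi>) = gasket \<xi>" by (simp add: graph_image_def gasket_def prod.map_id0)
  then have G': "strongly_converges (sierpinski r) ?ps (gasket \<xi>) (point \<xi>)" using G by simp
  show ?thesis
    by (rule strong_limit_unique[OF lim G']) (auto simp: sierpinski_def seq_prefix_words[OF \<xi>] gasket_locally_finite)
qed

lemma isomorphic_gaskets_iff: "isomorphic (gasket \<xi>) (gasket \<eta>) \<longleftrightarrow> (\<exists>\<phi> \<psi>. gasket_iso \<xi> \<eta> \<phi> \<psi>)"
proof
  assume "isomorphic (gasket \<xi>) (gasket \<eta>)"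
  then obtain \<phi> where bij: "bij_betw \<phi> (verts (gasket \<xi>)) (verts (gasket \<eta>))"
    and e: "\<And>u v. u \<in> verts (gasket \<xi>) \<Longrightarrow> v \<in> verts (gasket \<xi>) \<Longrightarrow> (u, v) \<in> edges (gasket \<xi>) \<longleftrightarrow> (\<phi> u, \<phi> v) \<in> edges (gasket \<eta>)"
    by (auto simp: isomorphic_def graph_isomorphism_def)
  let ?\<psi> = "inv_into (verts (gasket \<xi>)) \<phi>"
  have \<psi>: "?\<psi> b \<in> verts (gasket \<xi>) \<and> \<phi> (?\<psi> b) = b" if "b \<in> verts (gasket \<eta>)" for b
    using bij_betw_inv_into[OF bij] bij_betw_inv_into_right[OF bij that] that by (auto dest: bij_betwE)
  have \<phi>: "\<phi> a \<in> verts (gasket \<eta>) \<and> ?\<psi> (\<phi> a) = a" if "a \<in> verts (gasket \<xi>)" for a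
    using bij bij_betw_inv_into_left[OF bij that] that by (auto dest: bij_betwE)
  have wf: "a \<in> verts (gasket \<zeta>) \<and> b \<in> verts (gasket \<zeta>)" if "(a, b) \<in> edges (gasket \<zeta>)" for a b \<zeta>
    using gasket_simple[of \<zeta>] that by (auto simp: simple_graph_def)
  have "(\<phi> a, \<phi> b) \<in> edges (gasket \<eta>)" if "(a, b) \<in> edges (gasket \<xi>)" for a b
    using e wf[OF that] that by blast
  moreover have "(?\<psi> a, ?\<psi> b) \<in> edges (gasket \<xi>)" if "(a, b) \<in> edges (gasket \<eta>)" for a b
    using e[of "?\<psi> a" "?\<psi> b"] wf[OF that] that \<psi> by metis
  ultimately have "gasket_iso \<xi> \<eta> \<phi> ?\<psi>" unfolding gasket_iso_def using \<phi> \<psi> by blast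
  then show "\<exists>\<phi> \<psi>. gasket_iso \<xi> \<eta> \<phi> \<psi>" by blast
next
  assume "\<exists>\<phi> \<psi>. gasket_iso \<xi> \<eta> \<phi> \<psi>"
  then obtain \<phi> \<psi> where iso: "gasket_iso \<xi> \<eta> \<phi> \<psi>" by blast
  have bij: "bij_betw \<phi> (verts (gasket \<xi>)) (verts (gasket \<eta>))"
    by (rule bij_betw_byWitness[where f' = \<psi>]) (use iso in \<open>auto simp: gasket_iso_def\<close>)
  have "(u, v) \<in> edges (gasket \<xi>) \<longleftrightarrow> (\<phi> u, \<phi> v) \<in> edges (gasket \<eta>)"
    if uv: "u \<in> verts (gasket \<xi>)" "v \<in> verts (gasket \<xi>)" for u v
  proof
    assume "(\<phi> u, \<phi> v) \<in> edges (gasket \<eta>)"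
    then have "(\<psi> (\<phi> u), \<psi> (\<phi> v)) \<in> edges (gasket \<xi>)" using iso by (auto simp: gasket_iso_def)
    then show "(u, v) \<in> edges (gasket \<xi>)" using iso uv by (simp add: gasket_iso_def)
  qed (use iso in \<open>auto simp: gasket_iso_def\<close>)
  then show "isomorphic (gasket \<xi>) (gasket \<eta>)" using bij unfolding isomorphic_def graph_isomorphism_def by blast
qed

end

theorem theorem2p4:
  fixes r :: nat and \<xi> \<eta> :: "nat \<Rightarrow> nat"
  assumes "r \<ge> 3" and "\<not> 4 dvd r"
    and "\<And>n. \<xi> n \<in> {..<r}" and "\<And>n. \<eta> n \<in> {..<r}"
  shows "isomorphic (limit_graph r \<xi>) (limit_graph r \<eta>) \<longleftrightarrow>
         (\<exists>\<sigma>\<in>dihedral r. cofinal_seqs \<eta> (\<sigma> \<circ> \<xi>))"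
proof -
  interpret polygon_gasket r
    using assms(1,2) by unfold_locales auto
  have seqs: "\<xi> \<in> seqs" "\<eta> \<in> seqs" using assms(3,4) by (auto simp: seqs_def)
  note lim = limit_graph_isomorphic_gasket[OF seqs(1)] limit_graph_isomorphic_gasket[OF seqs(2)]
  have "isomorphic (limit_graph r \<xi>) (limit_graph r \<eta>) \<longleftrightarrow> isomorphic (gasket \<xi>) (gasket \<eta>)"
  proof
    assume "isomorphic (limit_graph r \<xi>) (limit_graph r \<eta>)"
    from isomorphic_trans[OF isomorphic_trans[OF isomorphic_sym[OF lim(1)] this] lim(2)]
    show "isomorphic (gasket \<xi>) (gasket \<eta>)" .
  next
    assume "isomorphic (gasket \<xi>) (gasket \<eta>)"
    from isomorphic_trans[OF isomorphic_trans[OF lim(1) this] isomorphic_sym[OF lim(2)]]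
    show "isomorphic (limit_graph r \<xi>) (limit_graph r \<eta>)" .
  qed
  then show ?thesis using isomorphic_gaskets_iff gasket_iso_iff[OF seqs(1)] by simp
qed

end
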